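(* There is no realizable $16_4$-configuration.
   Context: A $16_4$-configuration is a simple matroid $M$ of rank $3$ on $16$ elements (called points) such that every line (rank-2 flat) of $M$ contains at most $4$ points, and each point is contained in exactly $4$ lines that have exactly $4$ points. It is realizable if it can be drawn with straight lines in the real projective plane with exactly the prescribed incidences, i.e. if $M$ is representable over $\mathbb{R}$: there are $16$ distinct points in the real projective plane, labelled by the elements of $M$, such that a set of these points is collinear if and only if the corresponding set of elements has rank at most $2$ in $M$. (Equivalently, by polarity, there are $16$ distinct lines labelled by the elements of $M$ such that a set of them has a common point if and only if the corresponding set of elements has rank at most $2$ in $M$.) *)

theory Defs
  imports "HOL-Analysis.Analysis"
begin

locale matroid =
  fixes E :: "'a set" and indep :: "'a set \<Rightarrow> bool"
  assumes finite_ground: "finite E"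
    and indep_subset: "indep I \<Longrightarrow> I \<subseteq> E"
    and indep_empty: "indep {}"
    and indep_hereditary: "indep J \<Longrightarrow> I \<subseteq> J \<Longrightarrow> indep I"
    and indep_augment:
      "indep I \<Longrightarrow> indep J \<Longrightarrow> card I < card J \<Longrightarrow> \<exists>x \<in> J - I. indep (insert x I)"
begin

definition rank :: "'a set \<Rightarrow> nat"
  where "rank X = Max {card I | I. I \<subseteq> X \<and> indep I}"

definition flat :: "'a set \<Rightarrow> bool"
  where "flat F \<longleftrightarrow> F \<subseteq> E \<and> (\<forall>x \<in> E - F. rank F < rank (insert x F))"

definition line :: "'a set \<Rightarrow> bool"
  where "line L \<longleftrightarrow> flat L \<and> rank L = 2"

definition loop :: "'a \<Rightarrow> bool"
  where "loop x \<longleftrightarrow> x \<in> E \<and> \<not> indep {x}"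

definition parallel :: "'a \<Rightarrow> 'a \<Rightarrow> bool"
  where "parallel x y \<longleftrightarrow>
    x \<in> E \<and> y \<in> E \<and> x \<noteq> y \<and> \<not> loop x \<and> \<not> loop y \<and> \<not> indep {x, y}"

definition simple :: bool
  where "simple \<longleftrightarrow> (\<forall>x. \<not> loop x) \<and> (\<forall>x y. \<not> parallel x y)"

end

locale configuration_16_4 = matroid +
  assumes simple: "simple"
    and rank_ground: "rank E = 3"
    and card_ground: "card E = 16"
    and card_line_le: "line L \<Longrightarrow> card L \<le> 4"
    and four_lines: "x \<in> E \<Longrightarrow> card {L. line L \<and> x \<in> L \<and> card L = 4} = 4"

text \<open>The points and lines of the real projective plane are the one- and two-dimensional linear
  subspaces of three-dimensional real space, and incidence is inclusion.\<close>

definition proj_points :: "(real ^ 3) set set"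
  where "proj_points = {P. subspace P \<and> dim P = 1}"

definition proj_lines :: "(real ^ 3) set set"
  where "proj_lines = {W. subspace W \<and> dim W = 2}"

definition proj_collinear :: "(real ^ 3) set set \<Rightarrow> bool"
  where "proj_collinear S \<longleftrightarrow> (\<exists>W \<in> proj_lines. \<forall>P \<in> S. P \<subseteq> W)"

text \<open>Intended for simple matroids of rank 3: injectivity of the labelling makes the
  points distinct, and collinearity is prescribed for every set of elements.\<close>

definition (in matroid) realizable :: bool
  where "realizable \<longleftrightarrow>
    (\<exists>p :: 'a \<Rightarrow> (real ^ 3) set.
       inj_on p E \<and> p ` E \<subseteq> proj_points \<and>
       (\<forall>S \<subseteq> E. proj_collinear (p ` S) \<longleftrightarrow> rank S \<le> 2))"

end

theory Submission
  imports Defs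
begin

text \<open>
  Represent the sixteen points by vectors in three-dimensional space and pass to the dual
  arrangement of planes through the origin, which cuts the unit sphere into cells. Counting cells
  by adding one plane at a time gives Euler's relation. If a configuration existed, the cells would
  be triangles with few exceptions, while there would be many simple crossings (vertices on just two
  of the planes). A discharging argument shows that this is too much: give a cell with \<open>k\<close> edges
  and \<open>d\<close> simple corners the charge \<open>50 + 4 d - 18 k\<close>, and let every triangle send charge across
  each edge joining two simple corners. Two planes bound a lune, and a lune covered by at most four
  cells would force almost all planes through its two tips; hence triangles
  do not share such edges, and quadrangles stacked inside a lune are not capped by triangles at both
  ends. So no cell ends up with positive charge, which yields the inequality
  \<open>3 t\<^sub>2 + 4 t\<^sub>3 \<ge> 25 + 3 t\<^sub>4\<close> for the numbers \<open>t\<^sub>m\<close> of lines containing exactly \<open>m\<close> points. It contradicts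
  \<open>t\<^sub>4 = 16\<close> and \<open>t\<^sub>2 + 3 t\<^sub>3 + 6 t\<^sub>4 = 120\<close>.
\<close>

section \<open>Sign vectors of vector configurations\<close>

lemma cross3_orthogonal_parallel:
  fixes a b x :: "real^3"
  assumes "a \<bullet> x = 0" "b \<bullet> x = 0" "cross3 a b \<noteq> 0"
  shows "\<exists>c. x = c *\<^sub>R cross3 a b"
proof -
  let ?v = "cross3 a b"
  have "cross3 x ?v = 0"
    using assms by (simp add: Lagrange inner_commute)
  then have "cross3 ?v (cross3 x ?v) = 0" by simp
  then have "(?v \<bullet> ?v) *\<^sub>R x = (?v \<bullet> x) *\<^sub>R ?v" by (subst (asm) Lagrange) simp
  then have "(1 / (?v \<bullet> ?v)) *\<^sub>R (?v \<bullet> ?v) *\<^sub>R x = (1 / (?v \<bullet> ?v)) *\<^sub>R (?v \<bullet> x) *\<^sub>R ?v"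
    by simp
  then have "x = ((?v \<bullet> x) / (?v \<bullet> ?v)) *\<^sub>R ?v"
    using assms(3) by simp
  then show ?thesis by blast
qed

text \<open>Cramer's rule. It expands a vector in three others; when these are dependent it
  degenerates to a linear relation between them.\<close>

lemma cramer_cross3:
  fixes a b c x :: "real^3"
  shows "(a \<bullet> cross3 b c) *\<^sub>R x =
    (x \<bullet> cross3 b c) *\<^sub>R a + (x \<bullet> cross3 c a) *\<^sub>R b + (x \<bullet> cross3 a b) *\<^sub>R c"
  by (simp add: vec_eq_iff forall_3 cross_components inner_vec_def sum_3 algebra_simps)

lemma solve_two:
  fixes a b :: "real^3"
  assumes "cross3 a b \<noteq> 0"
  shows "\<exists>w. a \<bullet> w = s \<and> b \<bullet> w = t"
proof -
  let ?v = "cross3 a b"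
  have n: "?v \<bullet> ?v \<noteq> 0" using assms by simp
  have "a \<bullet> cross3 b v = v \<bullet> cross3 a b" "b \<bullet> cross3 a v = - (v \<bullet> cross3 a b)" for v
    by (simp_all add: cross3_simps)
  note 1 = this[of ?v]
  have 2: "b \<bullet> cross3 b ?v = 0" "a \<bullet> cross3 a ?v = 0"
    by (simp_all add: dot_cross_self)
  show ?thesis
    by (rule exI[of _ "(s / (?v \<bullet> ?v)) *\<^sub>R cross3 b ?v - (t / (?v \<bullet> ?v)) *\<^sub>R cross3 a ?v"])
      (use n in \<open>simp add: inner_diff_right 1 2\<close>)
qed

lemma solve_three:
  fixes a b c :: "real^3"
  assumes "a \<bullet> cross3 b c \<noteq> 0"
  shows "\<exists>w. a \<bullet> w = s \<and> b \<bullet> w = t \<and> c \<bullet> w = u"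
proof -
  let ?d = "a \<bullet> cross3 b c"
  have 1: "b \<bullet> cross3 c a = ?d" "c \<bullet> cross3 a b = ?d"
    by (simp_all add: cross3_simps)
  show ?thesis
    by (rule exI[of _ "(s / ?d) *\<^sub>R cross3 b c + (t / ?d) *\<^sub>R cross3 c a + (u / ?d) *\<^sub>R cross3 a b"])
      (use assms in \<open>simp add: inner_add_right 1 dot_cross_self\<close>)
qed

text \<open>A strict sign at \<open>x\<close> survives a small step by continuity; where
  \<open>P i\<close> is orthogonal to \<open>x\<close>, the direction \<open>w\<close> alone
  decides. This pushes points lying on some of the planes into cells.\<close>

lemma perturb_signs:
  fixes P :: "'a \<Rightarrow> 'v::real_inner" and s :: "'a \<Rightarrow> real"
  assumes "finite A"
    and "\<And>i. i \<in> A \<Longrightarrow> s i * (P i \<bullet> x) > 0 \<or> P i \<bullet> x = 0 \<and> s i * (P i \<bullet> w) > 0"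
  shows "\<exists>e>0. \<forall>i\<in>A. s i * (P i \<bullet> (x + e *\<^sub>R w)) > 0"
proof -
  have "\<forall>\<^sub>F e in at_right 0. s i * (P i \<bullet> (x + e *\<^sub>R w)) > 0" if "i \<in> A" for i
  proof (cases "P i \<bullet> x = 0")
    case True
    then have "s i * (P i \<bullet> w) > 0" using assms(2)[OF that] by auto
    then have "s i * (P i \<bullet> (x + e *\<^sub>R w)) > 0" if "e > 0" for e
      using mult_pos_pos[OF that] True by (simp add: inner_add_right mult.left_commute[of _ e])
    then show ?thesis
      using eventually_at_right_less[of "0::real"] by (auto elim!: eventually_mono)
  next
    case False
    then have pos: "s i * (P i \<bullet> x) > 0" using assms(2)[OF that] by auto
    have "((\<lambda>e. s i * (P i \<bullet> (x + e *\<^sub>R w))) \<longlongrightarrow> s i * (P i \<bullet> (x + 0 *\<^sub>R w))) (at_right 0)"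
      by (intro tendsto_intros)
    then show ?thesis using pos by (simp add: order_tendstoD(1))
  qed
  then have "\<forall>\<^sub>F e in at_right (0::real). \<forall>i\<in>A. s i * (P i \<bullet> (x + e *\<^sub>R w)) > 0"
    using assms(1) by (simp add: eventually_ball_finite_distrib)
  then have "\<forall>\<^sub>F e in at_right (0::real). e > 0 \<and> (\<forall>i\<in>A. s i * (P i \<bullet> (x + e *\<^sub>R w)) > 0)"
    using eventually_at_right_less by (rule eventually_conj[rotated])
  then show ?thesis
    using eventually_happens'[OF trivial_limit_at_right_real] by blast
qed

text \<open>If the vector found for the smaller set is orthogonal to the new \<open>h\<close>, a
  small step along \<open>h\<close> itself repairs this without spoiling the other products.\<close>

lemma ex_nonorthogonal:
  fixes H :: "'v::real_inner set"
  assumes "finite H" "0 \<notin> H"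
  shows "\<exists>w. \<forall>h\<in>H. h \<bullet> w \<noteq> 0"
  using assms
proof (induction H)
  case (insert h H)
  then obtain w where w: "\<forall>k\<in>H. k \<bullet> w \<noteq> 0" by auto
  show ?case
  proof (cases "h \<bullet> w = 0")
    case False
    then show ?thesis using w by auto
  next
    case True
    have "\<exists>e>0. \<forall>k\<in>insert h H. (if k = h then 1 else sgn (k \<bullet> w)) * (k \<bullet> (w + e *\<^sub>R h)) > 0"
      using insert w True by (intro perturb_signs[where P = "\<lambda>k. k"]) (auto simp: sgn_if)
    then obtain e where "\<forall>k\<in>insert h H. (if k = h then 1 else sgn (k \<bullet> w)) * (k \<bullet> (w + e *\<^sub>R h)) > 0"
      by blast
    then show ?thesis
      by (intro exI[of _ "w + e *\<^sub>R h"]) force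
  qed
qed auto

text \<open>Strict sign conditions leave room to avoid finitely many further planes.\<close>

lemma perturb_generic:
  fixes H :: "'v::real_inner set"
  assumes "finite H" "0 \<notin> H" "finite A"
    and "\<And>i. i \<in> A \<Longrightarrow> s i * (P i \<bullet> x) > 0"
  shows "\<exists>y. (\<forall>h\<in>H. h \<bullet> y \<noteq> 0) \<and> (\<forall>i\<in>A. s i * (P i \<bullet> y) > 0)"
proof -
  obtain w where w: "\<forall>h\<in>H. h \<bullet> w \<noteq> 0" using ex_nonorthogonal assms by blast
  \<comment> \<open>The sum type merges two families: \<open>Inl\<close> keeps the prescribed signs,
    and \<open>Inr\<close> asks each member of \<open>H\<close> for its sign at \<open>x\<close> or,
    if it vanishes there, along \<open>w\<close>.\<close>
  define P' where "P' = (\<lambda>z. case z of Inl i \<Rightarrow> P i | Inr h \<Rightarrow> h)"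
  define s' where "s' = (\<lambda>z. case z of Inl i \<Rightarrow> s i | Inr h \<Rightarrow> if h \<bullet> x = 0 then sgn (h \<bullet> w) else sgn (h \<bullet> x))"
  have "\<exists>e>0. \<forall>z\<in>A <+> H. s' z * (P' z \<bullet> (x + e *\<^sub>R w)) > 0"
  proof (intro perturb_signs)
    fix z assume "z \<in> A <+> H"
    then show "0 < s' z * (P' z \<bullet> x) \<or> P' z \<bullet> x = 0 \<and> 0 < s' z * (P' z \<bullet> w)"
    proof
      fix i assume "i \<in> A" "z = Inl i"
      then show ?thesis using assms(4) by (simp add: P'_def s'_def)
    next
      fix h assume "h \<in> H" "z = Inr h"
      then show ?thesis using w by (cases "h \<bullet> x = 0") (auto simp: P'_def s'_def sgn_if)
    qed
  qed (use assms in simp)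
  then obtain e where e: "\<forall>z\<in>A <+> H. s' z * (P' z \<bullet> (x + e *\<^sub>R w)) > 0" by blast
  have "s i * (P i \<bullet> (x + e *\<^sub>R w)) > 0" if "i \<in> A" for i
    using bspec[OF e InlI[OF that]] by (simp add: P'_def s'_def)
  moreover have "h \<bullet> (x + e *\<^sub>R w) \<noteq> 0" if "h \<in> H" for h
    using bspec[OF e InrI[OF that]] by (auto simp: P'_def)
  ultimately show ?thesis by blast
qed

section \<open>Sign vectors; deletion and restriction of a plane\<close>

definition sg :: "'a set \<Rightarrow> 'a \<Rightarrow> real"
  where "sg \<sigma> i = (if i \<in> \<sigma> then 1 else - 1)"

text \<open>A sign vector is stored as its set of positive indices. Varying \<open>W\<close> covers
  the regions of the whole space, of a plane and of the axis of two planes.\<close>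

definition topes :: "('a \<Rightarrow> real^3) \<Rightarrow> 'a set \<Rightarrow> (real^3) set \<Rightarrow> 'a set set"
  where "topes P A W = {\<sigma>. \<sigma> \<subseteq> A \<and> (\<exists>x\<in>W. \<forall>i\<in>A. sg \<sigma> i * (P i \<bullet> x) > 0)}"

lemma sg_mult_self [simp]: "sg \<sigma> i * sg \<sigma> i = 1" "sg \<sigma> i * (sg \<sigma> i * x) = x"
  by (simp_all add: sg_def)

lemma sg_cong: "(i \<in> \<sigma> \<longleftrightarrow> i \<in> \<tau>) \<Longrightarrow> sg \<sigma> i = sg \<tau> i"
  by (simp add: sg_def)

lemma sg_positive_set: "P i \<bullet> x \<noteq> 0 \<Longrightarrow> i \<in> A \<Longrightarrow> sg {i\<in>A. P i \<bullet> x > 0} i * (P i \<bullet> x) > 0"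
  by (auto simp: sg_def)

lemma finite_topes: "finite A \<Longrightarrow> finite (topes P A W)"
  by (rule finite_subset[of _ "Pow A"]) (auto simp: topes_def)

lemma topes_positive_set:
  assumes "x \<in> W" "\<And>i. i \<in> A \<Longrightarrow> P i \<bullet> x \<noteq> 0"
  shows "{i\<in>A. P i \<bullet> x > 0} \<in> topes P A W"
  unfolding topes_def using assms sg_positive_set[of P] by (auto intro!: bexI[of _ x])

lemma topes_eq_positive_set:
  assumes "\<sigma> \<in> topes P A W"
  obtains x where "x \<in> W" "\<And>i. i \<in> A \<Longrightarrow> P i \<bullet> x \<noteq> 0" "\<sigma> = {i\<in>A. P i \<bullet> x > 0}"
proof -
  obtain x where x: "\<sigma> \<subseteq> A" "x \<in> W" "\<forall>i\<in>A. sg \<sigma> i * (P i \<bullet> x) > 0"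
    using assms by (auto simp: topes_def)
  show thesis
    by (rule that[of x]) (use x in \<open>auto simp: sg_def split: if_splits\<close>)
qed

text \<open>Split the sign vectors of \<open>insert a A\<close> by their sign at \<open>a\<close>
  and forget that sign. The union of the two halves belongs to the arrangement without
  \<open>a\<close>; their intersection consists of the regions cut in two by plane \<open>a\<close>,
  which match the regions inside that plane.\<close>

lemma
  assumes A: "finite A" "a \<notin> A" and W: "subspace W" and w: "w \<in> W" "P a \<bullet> w \<noteq> 0"
  shows topes_hyperplane: "topes P A (W \<inter> {x. P a \<bullet> x = 0}) =
      {\<sigma>. \<sigma> \<subseteq> A \<and> \<sigma> \<in> topes P (insert a A) W \<and> insert a \<sigma> \<in> topes P (insert a A) W}"
    and card_topes_insert: "card (topes P (insert a A) W) = card (topes P A W) + card (topes P A (W \<inter> {x. P a \<bullet> x = 0}))"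
proof -
  let ?T = "topes P (insert a A) W"
  define B0 where "B0 = {\<sigma>. \<sigma> \<subseteq> A \<and> \<sigma> \<in> ?T}"
  define B1 where "B1 = {\<sigma>. \<sigma> \<subseteq> A \<and> insert a \<sigma> \<in> ?T}"
  have B0: "B0 = {\<sigma>. \<sigma> \<subseteq> A \<and> (\<exists>x\<in>W. P a \<bullet> x < 0 \<and> (\<forall>i\<in>A. sg \<sigma> i * (P i \<bullet> x) > 0))}"
    using A(2) by (auto simp: B0_def topes_def sg_def)
  have sgi: "sg (insert a \<sigma>) i = sg \<sigma> i" if "i \<in> A" for i \<sigma>
    using that A(2) by (auto simp: sg_def)
  have B1: "B1 = {\<sigma>. \<sigma> \<subseteq> A \<and> (\<exists>x\<in>W. P a \<bullet> x > 0 \<and> (\<forall>i\<in>A. sg \<sigma> i * (P i \<bullet> x) > 0))}"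
  proof -
    have "sg (insert a \<sigma>) a = 1" for \<sigma> by (simp add: sg_def)
    then show ?thesis
      using A(2) by (auto simp: B1_def topes_def sgi)
  qed
  have fin: "finite B0" "finite B1"
    using A by (auto simp: B0_def B1_def)
  \<comment> \<open>A point on plane \<open>a\<close> can be pushed off to either side; the sign of
    \<open>u\<close> selects the side.\<close>
  have perturb: "\<exists>y\<in>W. u * (P a \<bullet> y) > 0 \<and> (\<forall>i\<in>A. sg \<sigma> i * (P i \<bullet> y) > 0)"
    if "x \<in> W" "P a \<bullet> x = 0" "\<forall>i\<in>A. sg \<sigma> i * (P i \<bullet> x) > 0" "u \<noteq> 0" for x \<sigma> u
  proof -
    let ?w = "(u * (P a \<bullet> w)) *\<^sub>R w"
    have "u * (P a \<bullet> ?w) = (u * (P a \<bullet> w))\<^sup>2" by (simp add: power2_eq_square algebra_simps)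
    then have pos: "u * (P a \<bullet> ?w) > 0" using that(4) w(2) by simp
    have "\<exists>e>0. \<forall>i\<in>insert a A. (if i = a then u else sg \<sigma> i) * (P i \<bullet> (x + e *\<^sub>R ?w)) > 0"
      using A that pos by (intro perturb_signs) auto
    then obtain e where e: "\<forall>i\<in>insert a A. (if i = a then u else sg \<sigma> i) * (P i \<bullet> (x + e *\<^sub>R ?w)) > 0"
      by blast
    have "x + e *\<^sub>R ?w \<in> W"
      using W w that by (intro subspace_add subspace_scale)
    moreover have "u * (P a \<bullet> (x + e *\<^sub>R ?w)) > 0" using e by simp
    moreover have "\<forall>i\<in>A. sg \<sigma> i * (P i \<bullet> (x + e *\<^sub>R ?w)) > 0"
      using e A(2) by (metis insertCI)
    ultimately show ?thesis by blast
  qed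
  have T: "?T = B0 \<union> insert a ` B1"
  proof -
    have "\<sigma> \<in> B0 \<union> insert a ` B1" if "\<sigma> \<in> ?T" for \<sigma>
    proof (cases "a \<in> \<sigma>")
      case True
      then have "\<sigma> = insert a (\<sigma> - {a})" by auto
      moreover have "\<sigma> - {a} \<in> B1"
        using that True by (auto simp: B1_def insert_absorb) (auto simp: topes_def)
      ultimately show ?thesis by blast
    next
      case False
      then show ?thesis using that by (auto simp: B0_def topes_def)
    qed
    then show ?thesis by (auto simp: B0_def B1_def)
  qed
  have hyperplane: "B0 \<inter> B1 = topes P A (W \<inter> {x. P a \<bullet> x = 0})"
  proof (intro set_eqI iffI)
    fix \<sigma> assume "\<sigma> \<in> B0 \<inter> B1"
    then obtain x y where xy: "\<sigma> \<subseteq> A" "x \<in> W" "P a \<bullet> x < 0" "\<forall>i\<in>A. sg \<sigma> i * (P i \<bullet> x) > 0"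
       "y \<in> W" "P a \<bullet> y > 0" "\<forall>i\<in>A. sg \<sigma> i * (P i \<bullet> y) > 0"
      by (auto simp: B0 B1)
    \<comment> \<open>Up to a positive factor, the point where the segment from \<open>x\<close> to
      \<open>y\<close> meets plane \<open>a\<close>; positive weights preserve all common
      signs.\<close>
    let ?z = "(P a \<bullet> y) *\<^sub>R x + (- (P a \<bullet> x)) *\<^sub>R y"
    have "?z \<in> W" using xy W by (intro subspace_add subspace_scale)
    moreover have "P a \<bullet> ?z = 0" by (simp add: inner_add_right inner_diff_right)
    moreover have "sg \<sigma> i * (P i \<bullet> ?z) > 0" if "i \<in> A" for i
    proof -
      have "sg \<sigma> i * (P i \<bullet> ?z) = (P a \<bullet> y) * (sg \<sigma> i * (P i \<bullet> x)) + (- (P a \<bullet> x)) * (sg \<sigma> i * (P i \<bullet> y))"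
        by (simp add: inner_add_right inner_diff_right algebra_simps)
      also have "\<dots> > 0" using xy that by (intro add_pos_pos mult_pos_pos[of "P a \<bullet> y"] mult_pos_pos[of "- (P a \<bullet> x)"]) auto
      finally show ?thesis .
    qed
    ultimately show "\<sigma> \<in> topes P A (W \<inter> {x. P a \<bullet> x = 0})"
      using xy(1) by (auto simp: topes_def intro!: bexI[of _ ?z])
  next
    fix \<sigma> assume "\<sigma> \<in> topes P A (W \<inter> {x. P a \<bullet> x = 0})"
    then obtain x where x: "\<sigma> \<subseteq> A" "x \<in> W" "P a \<bullet> x = 0" "\<forall>i\<in>A. sg \<sigma> i * (P i \<bullet> x) > 0"
      by (auto simp: topes_def)
    show "\<sigma> \<in> B0 \<inter> B1"
      using perturb[OF x(2-4), of 1] perturb[OF x(2-4), of "-1"] x(1) by (auto simp: B0 B1)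
  qed
  then show "topes P A (W \<inter> {x. P a \<bullet> x = 0}) =
      {\<sigma>. \<sigma> \<subseteq> A \<and> \<sigma> \<in> ?T \<and> insert a \<sigma> \<in> ?T}"
    by (auto simp: B0_def B1_def)
  have "card ?T = card B0 + card (insert a ` B1)"
    unfolding T using fin A(2) by (intro card_Un_disjoint) (auto simp: B0_def)
  also have "card (insert a ` B1) = card B1"
    using A(2) by (intro card_image inj_onI) (auto simp: B1_def)
  also have "card B0 + card B1 = card (B0 \<union> B1) + card (B0 \<inter> B1)"
    by (rule card_Un_Int[OF fin])
  also have "B0 \<union> B1 = topes P A W"
  proof -
    have "\<sigma> \<in> B0 \<union> B1" if "\<sigma> \<in> topes P A W" for \<sigma>
    proof -
      obtain x where x: "\<sigma> \<subseteq> A" "x \<in> W" "\<forall>i\<in>A. sg \<sigma> i * (P i \<bullet> x) > 0"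
        using \<open>\<sigma> \<in> topes P A W\<close> by (auto simp: topes_def)
      consider "P a \<bullet> x < 0" | "P a \<bullet> x > 0" | "P a \<bullet> x = 0" by linarith
      then show ?thesis
      proof cases
        case 3
        then show ?thesis using perturb[of x \<sigma> 1] x by (auto simp: B1)
      qed (use x in \<open>auto simp: B0 B1\<close>)
    qed
    then show ?thesis unfolding B0 B1 by (auto simp: topes_def)
  qed
  also note hyperplane
  finally show "card ?T = card (topes P A W) + card (topes P A (W \<inter> {x. P a \<bullet> x = 0}))" .
qed

lemma card_topes_empty: "0 \<in> W \<Longrightarrow> card (topes P {} W) = 1"
  by (subgoal_tac "topes P {} W = {{}}") (auto simp: topes_def)

section \<open>Cells, edges and simple corners\<close>

text \<open>Dual picture: \<open>i\<close> stands for the plane through the origin with normal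
  vector \<open>P i\<close>, and the nonzero cross products make these planes distinct.\<close>

locale arrangement =
  fixes E :: "'a set" and P :: "'a \<Rightarrow> real^3"
  assumes finite_E: "finite E"
    and cross_nonzero: "i \<in> E \<Longrightarrow> j \<in> E \<Longrightarrow> i \<noteq> j \<Longrightarrow> cross3 (P i) (P j) \<noteq> 0"
    and nonzero: "i \<in> E \<Longrightarrow> P i \<noteq> 0"
begin

section \<open>Joins and Euler's count of the regions\<close>

definition join :: "'a \<Rightarrow> 'a \<Rightarrow> 'a set"
  where "join i j = {k \<in> E. P k \<bullet> cross3 (P i) (P j) = 0}"

text \<open>Dually, each member is the set of all planes through one common axis, so the joins are
  the crossings of the arrangement.\<close>

definition joins :: "'a set set"
  where "joins = {join i j | i j. i \<in> E \<and> j \<in> E \<and> i \<noteq> j}"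

abbreviation plane :: "'a \<Rightarrow> (real^3) set"
  where "plane i \<equiv> {x. P i \<bullet> x = 0}"

lemma subspace_plane: "subspace (plane i)"
  by (auto simp: subspace_def inner_add_right)

lemma mem_join [simp]: "i \<in> E \<Longrightarrow> i \<in> join i j" "j \<in> E \<Longrightarrow> j \<in> join i j"
  by (auto simp: join_def dot_cross_self)

lemma join_subset: "join i j \<subseteq> E"
  by (auto simp: join_def)

lemma finite_joins: "finite joins"
  by (rule finite_subset[of _ "Pow E"]) (use finite_E join_subset in \<open>auto simp: joins_def\<close>)

lemma join_in_joins: "i \<in> E \<Longrightarrow> j \<in> E \<Longrightarrow> i \<noteq> j \<Longrightarrow> join i j \<in> joins"
  by (auto simp: joins_def)

lemma joins_eqI:
  assumes "L \<in> joins" "a \<in> L" "b \<in> L" "a \<noteq> b"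
  shows "L = join a b"
proof -
  obtain i j where L: "L = join i j" and ij: "i \<in> E" "j \<in> E" "i \<noteq> j"
    using assms(1) by (auto simp: joins_def)
  have "a \<in> E" "b \<in> E" "P a \<bullet> cross3 (P i) (P j) = 0" "P b \<bullet> cross3 (P i) (P j) = 0"
    using assms L by (auto simp: join_def)
  moreover from this obtain c where c: "cross3 (P i) (P j) = c *\<^sub>R cross3 (P a) (P b)"
    using cross3_orthogonal_parallel cross_nonzero assms(4) by metis
  moreover have "c \<noteq> 0" using c cross_nonzero[OF ij] by auto
  ultimately show ?thesis by (simp add: L join_def)
qed

text \<open>Two planes meet in an axis made of two opposite rays. A further plane either contains
  the axis, leaving no strict sign there, or separates the rays; since \<open>A\<close> is nonempty,
  the two sign vectors differ.\<close>

lemma card_topes_axis: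
  assumes ab: "a \<in> E" "b \<in> E" "a \<noteq> b" and A: "finite A" "A \<noteq> {}"
  shows "card (topes P A (plane a \<inter> plane b)) =
    (if \<exists>i\<in>A. P i \<bullet> cross3 (P a) (P b) = 0 then 0 else 2)"
proof -
  let ?v = "cross3 (P a) (P b)"
  have par: "\<exists>c. x = c *\<^sub>R ?v" if "x \<in> plane a \<inter> plane b" for x
    using that cross3_orthogonal_parallel cross_nonzero[OF ab] by auto
  show ?thesis
  proof (cases "\<exists>i\<in>A. P i \<bullet> ?v = 0")
    case True
    then have "topes P A (plane a \<inter> plane b) = {}"
      using par by (force simp: topes_def)
    then show ?thesis using True by simp
  next
    case False
    let ?S = "\<lambda>x. {i\<in>A. P i \<bullet> x > 0}"
    have "topes P A (plane a \<inter> plane b) = {?S ?v, ?S (- ?v)}"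
    proof (intro equalityI subsetI)
      fix \<sigma> assume "\<sigma> \<in> topes P A (plane a \<inter> plane b)"
      then obtain x where x: "x \<in> plane a \<inter> plane b" "\<And>i. i \<in> A \<Longrightarrow> P i \<bullet> x \<noteq> 0" "\<sigma> = ?S x"
        using topes_eq_positive_set by blast
      then obtain c where c: "x = c *\<^sub>R ?v" using par by blast
      have "c \<noteq> 0" using x(2) c A(2) by auto
      then consider "c > 0" | "c < 0" by linarith
      then have "?S x = ?S ?v \<or> ?S x = ?S (- ?v)"
      proof cases
        case 1
        then show ?thesis by (simp add: c zero_less_mult_iff)
      next
        case 2
        then show ?thesis by (simp add: c zero_less_mult_iff)
      qed
      then show "\<sigma> \<in> {?S ?v, ?S (- ?v)}" using x(3) by auto
    next
      fix \<sigma> assume "\<sigma> \<in> {?S ?v, ?S (- ?v)}"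
      moreover have "?v \<in> plane a \<inter> plane b" "- ?v \<in> plane a \<inter> plane b"
        by (simp_all add: dot_cross_self)
      ultimately show "\<sigma> \<in> topes P A (plane a \<inter> plane b)"
        using topes_positive_set[of ?v "plane a \<inter> plane b" A P]
          topes_positive_set[of "- ?v" "plane a \<inter> plane b" A P] False by auto
    qed
    moreover have "?S ?v \<noteq> ?S (- ?v)"
    proof -
      obtain i where i: "i \<in> A" using A(2) by blast
      then have "P i \<bullet> ?v \<noteq> 0" using False by blast
      then have "i \<in> ?S ?v \<longleftrightarrow> i \<notin> ?S (- ?v)" using i by auto
      then show ?thesis by blast
    qed
    ultimately show ?thesis using False by simp
  qed
qed

text \<open>In a plane, \<open>m\<close> lines through the origin bound \<open>2 * m\<close>
  sectors. The other planes cut plane \<open>a\<close> in one line per join, so a new plane adds 2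
  exactly when its join with \<open>a\<close> has not been met before.\<close>

lemma card_topes_plane:
  assumes "a \<in> E" "A \<subseteq> E" "a \<notin> A" "A \<noteq> {}"
  shows "card (topes P A (plane a)) = 2 * card {L \<in> joins. a \<in> L \<and> L \<inter> A \<noteq> {}}"
proof -
  have "finite A" using assms(2) finite_E finite_subset by blast
  then show ?thesis using assms
  proof (induction A)
    case (insert b A)
    have bE: "b \<in> E" and ab: "a \<noteq> b" and aA: "a \<notin> A" and AE: "A \<subseteq> E"
      using insert.prems by auto
    obtain w where w: "P a \<bullet> w = 0" "P b \<bullet> w = 1"
      using solve_two[OF cross_nonzero[OF \<open>a \<in> E\<close> bE ab]] by blast
    have rec: "card (topes P (insert b A) (plane a)) =
        card (topes P A (plane a)) + card (topes P A (plane a \<inter> plane b))"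
      using insert.hyps w by (intro card_topes_insert subspace_plane) auto
    have uniq: "L = join a b" if "L \<in> joins" "a \<in> L" "b \<in> L" for L
      using joins_eqI that ab by blast
    have J: "join a b \<in> joins" "a \<in> join a b" "b \<in> join a b"
      using join_in_joins bE ab \<open>a \<in> E\<close> by auto
    have U: "L \<in> joins \<and> a \<in> L \<and> b \<in> L \<longleftrightarrow> L = join a b" for L
      using uniq J by blast
    have "{L \<in> joins. a \<in> L \<and> L \<inter> insert b A \<noteq> {}} =
        {L \<in> joins. a \<in> L \<and> L \<inter> A \<noteq> {}} \<union> {L. L \<in> joins \<and> a \<in> L \<and> b \<in> L}"
      by blast
    then have S: "{L \<in> joins. a \<in> L \<and> L \<inter> insert b A \<noteq> {}} =
        insert (join a b) {L \<in> joins. a \<in> L \<and> L \<inter> A \<noteq> {}}"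
      unfolding U by simp
    have *: "(\<exists>i\<in>A. P i \<bullet> cross3 (P a) (P b) = 0) \<longleftrightarrow> join a b \<inter> A \<noteq> {}"
      using AE by (auto simp: join_def)
    show ?case
    proof (cases "A = {}")
      \<comment> \<open>The formula would give 0 regions for no lines, where there is one, so the
        first line is treated separately.\<close>
      case True
      then have "{L \<in> joins. a \<in> L \<and> L \<inter> insert b A \<noteq> {}} = {join a b}"
        unfolding S by simp
      moreover have "0 \<in> plane a" "0 \<in> plane a \<inter> plane b" by auto
      ultimately show ?thesis
        using rec True by (simp add: card_topes_empty)
    next
      case False
      have IH: "card (topes P A (plane a)) = 2 * card {L \<in> joins. a \<in> L \<and> L \<inter> A \<noteq> {}}"
        using insert False AE aA by blast
      show ?thesis
      proof (cases "join a b \<inter> A = {}")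
        case True
        have "card {L \<in> joins. a \<in> L \<and> L \<inter> insert b A \<noteq> {}} =
            Suc (card {L \<in> joins. a \<in> L \<and> L \<inter> A \<noteq> {}})"
          unfolding S using True finite_joins by simp
        then show ?thesis
          using rec IH True *
            card_topes_axis[OF \<open>a \<in> E\<close> bE ab insert.hyps(1) False] by simp
      next
        case nonempty: False
        have "{L \<in> joins. a \<in> L \<and> L \<inter> insert b A \<noteq> {}} = {L \<in> joins. a \<in> L \<and> L \<inter> A \<noteq> {}}"
          unfolding S using J nonempty by blast
        then show ?thesis
          using rec IH nonempty *
            card_topes_axis[OF \<open>a \<in> E\<close> bE ab insert.hyps(1) False] by simp
      qed
    qed
  qed simp
qed

text \<open>A new plane adds two regions for each join through it that already has a member in
  \<open>A\<close>. Thus a join contributes 2 for each of its members except the first; truncated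
  subtraction gives 0 for joins that miss \<open>A\<close>.\<close>

lemma card_topes_UNIV:
  assumes "A \<subseteq> E" "A \<noteq> {}"
  shows "card (topes P A UNIV) = 2 + 2 * (\<Sum>L\<in>joins. card (L \<inter> A) - 1)"
proof -
  have "finite A" using assms(1) finite_E finite_subset by blast
  then show ?thesis using assms
  proof (induction A)
    case (insert a A)
    have aE: "a \<in> E" and AE: "A \<subseteq> E" using insert.prems by auto
    have rec: "card (topes P (insert a A) UNIV) = card (topes P A UNIV) + card (topes P A (plane a))"
      using card_topes_insert[OF insert.hyps, of UNIV "P a" P] nonzero[OF aE] by simp
    show ?case
    proof (cases "A = {}")
      case True
      moreover have "0 \<in> plane a" by simp
      moreover have "(\<Sum>L\<in>joins. card (L \<inter> {a}) - 1) = 0"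
        by (intro sum.neutral) (auto simp: Int_insert_right)
      ultimately show ?thesis using rec by (simp add: card_topes_empty)
    next
      case False
      have "card (L \<inter> insert a A) - 1 = (card (L \<inter> A) - 1) + (if a \<in> L \<and> L \<inter> A \<noteq> {} then 1 else 0)" for L
      proof -
        have "finite (L \<inter> A)" using insert.hyps(1) by simp
        moreover from this have "L \<inter> A \<noteq> {} \<Longrightarrow> Suc (card (L \<inter> A) - Suc 0) = card (L \<inter> A)"
          by (simp add: card_gt_0_iff)
        ultimately show ?thesis
          using insert.hyps(2)
          by (cases "a \<in> L"; cases "L \<inter> A = {}") (simp_all add: Int_insert_right)
      qed
      then have "(\<Sum>L\<in>joins. card (L \<inter> insert a A) - 1) =
          (\<Sum>L\<in>joins. card (L \<inter> A) - 1) + card {L \<in> joins. a \<in> L \<and> L \<inter> A \<noteq> {}}"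
        using finite_joins by (simp add: sum.distrib sum.If_cases Int_def conj_commute)
      then show ?thesis
        using rec insert.IH[OF AE False] card_topes_plane[OF aE AE insert.hyps(2) False] by simp
    qed
  qed simp
qed

section \<open>Geometry of a single cell\<close>

definition cells :: "'a set set"
  where "cells = topes P E UNIV"

definition flip :: "'a \<Rightarrow> 'a set \<Rightarrow> 'a set"
  where "flip i \<sigma> = (if i \<in> \<sigma> then \<sigma> - {i} else insert i \<sigma>)"

text \<open>Convexity gives each plane at most one edge of a cell, so an edge is named by its plane.
  Adjacency of cells replaces closures and faces.\<close>

definition edges :: "'a set \<Rightarrow> 'a set"
  where "edges \<sigma> = {i \<in> E. flip i \<sigma> \<in> cells}"

text \<open>
  Only simple crossings count as corners: no further plane passes through \<open>v\<close>. The condition ignores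
  on which side of \<open>i\<close> and \<open>j\<close> the cell lies, so a corner is shared by all four cells around it.
\<close>

definition corner :: "'a set \<Rightarrow> 'a \<Rightarrow> 'a \<Rightarrow> bool"
  where "corner \<sigma> i j \<longleftrightarrow> i \<in> E \<and> j \<in> E \<and> i \<noteq> j \<and>
    (\<exists>v. P i \<bullet> v = 0 \<and> P j \<bullet> v = 0 \<and> (\<forall>k\<in>E - {i, j}. sg \<sigma> k * (P k \<bullet> v) > 0))"

definition nbs :: "'a set \<Rightarrow> 'a \<Rightarrow> 'a set"
  where "nbs \<sigma> i = {j. corner \<sigma> i j}"

lemma flip_flip [simp]: "flip i (flip i \<sigma>) = \<sigma>"
  by (auto simp: flip_def)

lemma mem_flip: "j \<in> flip i \<sigma> \<longleftrightarrow> (if j = i then j \<notin> \<sigma> else j \<in> \<sigma>)"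
  by (auto simp: flip_def)

lemma sg_flip: "sg (flip i \<sigma>) j = (if j = i then - sg \<sigma> j else sg \<sigma> j)"
  by (auto simp: sg_def mem_flip)

lemma finite_cells: "finite cells"
  by (simp add: cells_def finite_topes finite_E)

lemma finite_edges: "finite (edges \<sigma>)"
  by (rule finite_subset[OF _ finite_E]) (auto simp: edges_def)

lemma cells_iff: "\<sigma> \<in> cells \<longleftrightarrow> \<sigma> \<subseteq> E \<and> (\<exists>x. \<forall>i\<in>E. sg \<sigma> i * (P i \<bullet> x) > 0)"
  by (auto simp: cells_def topes_def)

lemma flip_cell: "i \<in> edges \<sigma> \<Longrightarrow> flip i \<sigma> \<in> cells"
  by (simp add: edges_def)

lemma edges_flip: "\<sigma> \<in> cells \<Longrightarrow> i \<in> edges \<sigma> \<Longrightarrow> i \<in> edges (flip i \<sigma>)"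
  by (simp add: edges_def)

lemma corner_sym: "corner \<sigma> i j \<longleftrightarrow> corner \<sigma> j i"
  unfolding corner_def by (auto simp: insert_commute)

lemma corner_cong:
  assumes "\<And>k. k \<in> E - {i, j} \<Longrightarrow> k \<in> \<sigma> \<longleftrightarrow> k \<in> \<tau>"
  shows "corner \<sigma> i j \<longleftrightarrow> corner \<tau> i j"
proof -
  have "sg \<sigma> k = sg \<tau> k" if "k \<in> E - {i, j}" for k
    using assms[OF that] by (rule sg_cong)
  then show ?thesis unfolding corner_def by simp
qed

lemma nbs_flip [simp]: "nbs (flip i \<sigma>) i = nbs \<sigma> i"
  unfolding nbs_def using corner_cong[of i _ "flip i \<sigma>" \<sigma>] by (auto simp: mem_flip)

text \<open>Move from a point of \<open>\<sigma>\<close> in the direction of a point of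
  \<open>\<tau>\<close>. From a generic start the separating planes are crossed one at a time, and
  the first of them is an edge of \<open>\<sigma>\<close>.\<close>

lemma separating_edge:
  assumes "\<sigma> \<in> cells" "\<tau> \<in> cells" "\<sigma> \<noteq> \<tau>"
  shows "\<exists>i\<in>edges \<sigma>. (i \<in> \<sigma>) \<noteq> (i \<in> \<tau>)"
proof -
  obtain x where x: "\<forall>i\<in>E. sg \<sigma> i * (P i \<bullet> x) > 0" and \<sigma>: "\<sigma> \<subseteq> E"
    using assms(1) by (auto simp: cells_iff)
  obtain y where y: "\<forall>i\<in>E. sg \<tau> i * (P i \<bullet> y) > 0" and \<tau>: "\<tau> \<subseteq> E"
    using assms(2) by (auto simp: cells_iff)
  define S where "S = {i \<in> E. (i \<in> \<sigma>) \<noteq> (i \<in> \<tau>)}"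
  have S: "S \<noteq> {}" "finite S" using \<sigma> \<tau> assms(3) finite_E by (auto simp: S_def)
  have y0: "P i \<bullet> y \<noteq> 0" if "i \<in> E" for i using y that by force
  \<comment> \<open>\<open>h (i, j)\<close> is orthogonal to \<open>z\<close> exactly when the ray
    from \<open>z\<close> in direction \<open>y\<close> crosses \<open>i\<close> and
    \<open>j\<close> simultaneously.\<close>
  define h where "h = (\<lambda>(i, j). (P j \<bullet> y) *\<^sub>R P i - (P i \<bullet> y) *\<^sub>R P j)"
  define H where "H = h ` {(i, j). i \<in> E \<and> j \<in> E \<and> i \<noteq> j}"
  have "finite {(i, j). i \<in> E \<and> j \<in> E \<and> i \<noteq> j}"
    by (rule finite_subset[of _ "E \<times> E"]) (use finite_E in auto)
  then have "finite H" unfolding H_def by simp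
  moreover have "0 \<notin> H"
  proof
    assume "0 \<in> H"
    then obtain i j where ij: "i \<in> E" "j \<in> E" "i \<noteq> j" "(P j \<bullet> y) *\<^sub>R P i = (P i \<bullet> y) *\<^sub>R P j"
      by (auto simp: H_def h_def)
    then have "cross3 ((P j \<bullet> y) *\<^sub>R P i) (P j) = 0" by (simp add: cross_mult_left)
    then show False using y0 cross_nonzero ij(1-3) by (simp add: cross_mult_left)
  qed
  ultimately obtain z where zH: "\<forall>g\<in>H. g \<bullet> z \<noteq> 0" and z: "\<forall>i\<in>E. sg \<sigma> i * (P i \<bullet> z) > 0"
    using perturb_generic[of H E "sg \<sigma>" P x] x finite_E by blast
  \<comment> \<open>The parameter at which \<open>z + t *\<^sub>R y\<close> meets plane
    \<open>i\<close>; it is positive for the separating planes.\<close>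
  define q where "q i = - (P i \<bullet> z) / (P i \<bullet> y)" for i
  have sgS: "sg \<tau> i = - sg \<sigma> i" if "i \<in> S" for i using that by (auto simp: S_def sg_def)
  have sgE: "sg \<tau> i = sg \<sigma> i" if "i \<in> E - S" for i using that by (auto simp: S_def sg_def)
  have SE: "S \<subseteq> E" by (auto simp: S_def)
  have qpos: "q i > 0" if "i \<in> S" for i
  proof -
    have "sg \<sigma> i * (P i \<bullet> z) > 0" "sg \<sigma> i * (P i \<bullet> y) < 0"
      using z y SE that sgS[OF that] by force+
    then show ?thesis unfolding q_def
      by (cases "i \<in> \<sigma>") (auto simp: sg_def divide_pos_neg divide_neg_pos)
  qed
  have at_q: "P i \<bullet> (z + t *\<^sub>R y) = (t - q i) * (P i \<bullet> y)" if "i \<in> E" for i t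
    using y0[OF that] by (simp add: q_def inner_add_right field_simps)
  have q_inj: "q i \<noteq> q j" if "i \<in> S" "j \<in> S" "i \<noteq> j" for i j
  proof
    assume "q i = q j"
    then have "(P i \<bullet> z) * (P j \<bullet> y) = (P j \<bullet> z) * (P i \<bullet> y)"
      using y0[of i] y0[of j] that SE by (simp add: q_def frac_eq_eq subset_iff)
    then have "h (i, j) \<bullet> z = 0" by (simp add: h_def inner_diff_left algebra_simps)
    moreover have "h (i, j) \<in> H" using that SE by (auto simp: H_def)
    ultimately show False using zH by blast
  qed
  obtain i where i: "i \<in> S" "\<And>j. j \<in> S \<Longrightarrow> q i \<le> q j"
    using ex_is_arg_min_if_finite[OF S(2,1), of q] by (auto simp: is_arg_min_linorder)
  let ?u = "z + q i *\<^sub>R y"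
  have iE: "i \<in> E" using i SE by auto
  have "sg (flip i \<sigma>) j * (P j \<bullet> ?u) > 0 \<or> P j \<bullet> ?u = 0 \<and> sg (flip i \<sigma>) j * (P j \<bullet> y) > 0"
    if "j \<in> E" for j
  proof (cases "j = i")
    case True
    then show ?thesis using at_q[OF iE, of "q i"] y iE sgS[OF i(1)] by (auto simp: sg_flip)
  next
    case False
    show ?thesis
    proof (cases "j \<in> S")
      case True
      then have "q i < q j" using i q_inj[of i j] False by force
      moreover have "sg \<sigma> j * (P j \<bullet> y) < 0" using y that sgS[OF True] by force
      ultimately have "(q i - q j) * (sg \<sigma> j * (P j \<bullet> y)) > 0" by (simp add: mult_neg_neg)
      then show ?thesis using at_q[OF that, of "q i"] False by (simp add: sg_flip mult.left_commute)
    next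
      case notS: False
      have "sg \<sigma> j * (P j \<bullet> z) > 0" using z that by auto
      moreover have "q i * (sg \<sigma> j * (P j \<bullet> y)) > 0"
        using y that sgE[of j] notS qpos[OF i(1)] by (metis DiffI mult_pos_pos)
      ultimately have "sg \<sigma> j * (P j \<bullet> z) + q i * (sg \<sigma> j * (P j \<bullet> y)) > 0" by simp
      then show ?thesis using False by (simp add: sg_flip inner_add_right algebra_simps)
    qed
  qed
  \<comment> \<open>Just beyond the first crossing, only the sign at \<open>i\<close> has
    changed.\<close>
  then have "\<exists>e>0. \<forall>j\<in>E. sg (flip i \<sigma>) j * (P j \<bullet> (?u + e *\<^sub>R y)) > 0"
    using finite_E by (intro perturb_signs) auto
  moreover have "flip i \<sigma> \<subseteq> E" using \<sigma> iE by (auto simp: flip_def)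
  ultimately have "flip i \<sigma> \<in> cells" by (auto simp: cells_iff)
  then show ?thesis using i(1) by (auto simp: edges_def S_def)
qed

text \<open>A cell is the intersection of the half-spaces of its edges. This identifies the cells
  inside a lune below.\<close>

lemma cell_eq_if_agree_on_edges:
  assumes "\<sigma> \<in> cells" "\<tau> \<in> cells" "\<And>i. i \<in> edges \<sigma> \<Longrightarrow> i \<in> \<tau> \<longleftrightarrow> i \<in> \<sigma>"
  shows "\<tau> = \<sigma>"
  using separating_edge[of \<sigma> \<tau>] assms by blast

text \<open>Near a simple crossing all four combinations of sides of \<open>i\<close> and
  \<open>j\<close> occur.\<close>

lemma corner_cells:
  assumes "corner \<sigma> i j" "\<sigma> \<subseteq> E"
  shows "\<sigma> \<in> cells"
proof -
  obtain v where v: "P i \<bullet> v = 0" "P j \<bullet> v = 0" "\<forall>k\<in>E - {i, j}. sg \<sigma> k * (P k \<bullet> v) > 0"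
    and ij: "i \<in> E" "j \<in> E" "i \<noteq> j"
    using assms(1) by (auto simp: corner_def)
  obtain w where w: "P i \<bullet> w = sg \<sigma> i" "P j \<bullet> w = sg \<sigma> j"
    using solve_two[OF cross_nonzero[OF ij]] by blast
  have "\<exists>e>0. \<forall>k\<in>E. sg \<sigma> k * (P k \<bullet> (v + e *\<^sub>R w)) > 0"
    using v w finite_E by (intro perturb_signs) auto
  then show ?thesis using assms(2) by (auto simp: cells_iff)
qed

lemma corner_edges:
  assumes "corner \<sigma> i j" "\<sigma> \<subseteq> E"
  shows "i \<in> edges \<sigma>" "j \<in> edges \<sigma>"
proof -
  have *: "i \<in> edges \<sigma>" if "corner \<sigma> i j" for i j
  proof -
    have i: "i \<in> E" using that by (simp add: corner_def)
    have "corner (flip i \<sigma>) i j"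
      using that corner_cong[of i j "flip i \<sigma>" \<sigma>] by (auto simp: mem_flip)
    moreover have "flip i \<sigma> \<subseteq> E" using assms(2) i by (auto simp: flip_def)
    ultimately show ?thesis using corner_cells i by (auto simp: edges_def)
  qed
  show "i \<in> edges \<sigma>" "j \<in> edges \<sigma>"
    using *[of i j] *[of j i] assms(1) corner_sym by blast+
qed

lemma nbs_subset_edges: "\<sigma> \<in> cells \<Longrightarrow> nbs \<sigma> i \<subseteq> edges \<sigma>"
  using corner_edges by (auto simp: nbs_def cells_iff)

lemma finite_nbs: "\<sigma> \<in> cells \<Longrightarrow> finite (nbs \<sigma> i)"
  using nbs_subset_edges finite_edges finite_subset by blast

text \<open>By convexity an edge has at most two ends. Three corners on plane \<open>i\<close> would
  be linearly dependent vectors; each of the three other planes contains one of them and has the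
  remaining two on the same side, so the coefficients have pairwise opposite signs.\<close>

lemma card_nbs_le_2:
  assumes "\<sigma> \<in> cells"
  shows "card (nbs \<sigma> i) \<le> 2"
proof (rule ccontr)
  assume "\<not> card (nbs \<sigma> i) \<le> 2"
  then obtain B where "B \<subseteq> nbs \<sigma> i" "card B = 3"
    using obtain_subset_with_card_n[of 3 "nbs \<sigma> i"] by auto
  then obtain j k l where jkl: "corner \<sigma> i j" "corner \<sigma> i k" "corner \<sigma> i l"
      and d: "j \<noteq> k" "k \<noteq> l" "j \<noteq> l"
    by (auto simp: nbs_def card_3_iff)
  then have E: "i \<in> E" "j \<in> E" "k \<in> E" "l \<in> E" "i \<noteq> j" "i \<noteq> k" "i \<noteq> l" by (auto simp: corner_def)
  obtain a where a: "P i \<bullet> a = 0" "P j \<bullet> a = 0" "\<forall>m\<in>E - {i, j}. sg \<sigma> m * (P m \<bullet> a) > 0"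
    using jkl(1) by (auto simp: corner_def)
  obtain b where b: "P i \<bullet> b = 0" "P k \<bullet> b = 0" "\<forall>m\<in>E - {i, k}. sg \<sigma> m * (P m \<bullet> b) > 0"
    using jkl(2) by (auto simp: corner_def)
  obtain c where c: "P i \<bullet> c = 0" "P l \<bullet> c = 0" "\<forall>m\<in>E - {i, l}. sg \<sigma> m * (P m \<bullet> c) > 0"
    using jkl(3) by (auto simp: corner_def)
  define \<alpha> \<beta> \<gamma> where "\<alpha> = P i \<bullet> cross3 b c" and "\<beta> = P i \<bullet> cross3 c a" and "\<gamma> = P i \<bullet> cross3 a b"
  have dep: "\<alpha> *\<^sub>R a + \<beta> *\<^sub>R b + \<gamma> *\<^sub>R c = 0"
  proof -
    have eq: "(a \<bullet> cross3 b c) *\<^sub>R P i = \<alpha> *\<^sub>R a + \<beta> *\<^sub>R b + \<gamma> *\<^sub>R c"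
      unfolding \<alpha>_def \<beta>_def \<gamma>_def by (rule cramer_cross3)
    have "P i \<bullet> ((a \<bullet> cross3 b c) *\<^sub>R P i) = 0"
      unfolding eq using a b c by (simp add: inner_add_right)
    then have "a \<bullet> cross3 b c = 0" using nonzero[OF E(1)] by simp
    then show ?thesis using eq by simp
  qed
  have lin: "\<alpha> * (sg \<sigma> m * (P m \<bullet> a)) + \<beta> * (sg \<sigma> m * (P m \<bullet> b)) + \<gamma> * (sg \<sigma> m * (P m \<bullet> c)) = 0" for m
  proof -
    have "sg \<sigma> m * (P m \<bullet> (\<alpha> *\<^sub>R a + \<beta> *\<^sub>R b + \<gamma> *\<^sub>R c)) = 0" unfolding dep by simp
    then show ?thesis by (simp add: inner_add_right algebra_simps)
  qed
  have opp: "(s > 0 \<longleftrightarrow> t < 0) \<and> (s < 0 \<longleftrightarrow> t > 0)" if "s * p + t * q = 0" "p > 0" "q > 0" for s t p q :: real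
  proof -
    have "s > 0 \<longleftrightarrow> s * p > 0" "s < 0 \<longleftrightarrow> s * p < 0" "t > 0 \<longleftrightarrow> t * q > 0" "t < 0 \<longleftrightarrow> t * q < 0"
      using that by (simp_all add: zero_less_mult_iff mult_less_0_iff)
    then show ?thesis using that by linarith
  qed
  have pos: "sg \<sigma> j * (P j \<bullet> b) > 0" "sg \<sigma> j * (P j \<bullet> c) > 0" "sg \<sigma> k * (P k \<bullet> a) > 0"
     "sg \<sigma> k * (P k \<bullet> c) > 0" "sg \<sigma> l * (P l \<bullet> a) > 0" "sg \<sigma> l * (P l \<bullet> b) > 0"
    using a b c E d by auto
  have "(\<beta> > 0 \<longleftrightarrow> \<gamma> < 0) \<and> (\<beta> < 0 \<longleftrightarrow> \<gamma> > 0)"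
    using lin[of j] pos a by (intro opp[of _ "sg \<sigma> j * (P j \<bullet> b)" _ "sg \<sigma> j * (P j \<bullet> c)"]) auto
  moreover have "(\<alpha> > 0 \<longleftrightarrow> \<gamma> < 0) \<and> (\<alpha> < 0 \<longleftrightarrow> \<gamma> > 0)"
    using lin[of k] pos b by (intro opp[of _ "sg \<sigma> k * (P k \<bullet> a)" _ "sg \<sigma> k * (P k \<bullet> c)"]) auto
  moreover have "(\<alpha> > 0 \<longleftrightarrow> \<beta> < 0) \<and> (\<alpha> < 0 \<longleftrightarrow> \<beta> > 0)"
    using lin[of l] pos c by (intro opp[of _ "sg \<sigma> l * (P l \<bullet> a)" _ "sg \<sigma> l * (P l \<bullet> b)"]) auto
  \<comment> \<open>Three numbers with pairwise opposite signs vanish. Then \<open>b\<close> and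
    \<open>c\<close> are parallel, although plane \<open>k\<close> contains \<open>b\<close> but not
    \<open>c\<close>.\<close>
  ultimately have "\<alpha> = 0" by linarith
  then have "cross3 (P i) (cross3 b c) = 0" "P i \<bullet> cross3 b c = 0"
    using b c by (simp_all add: \<alpha>_def Lagrange)
  then have "cross3 b c = 0"
    using nonzero[OF E(1)] cross_dot_cancel[of "P i" "cross3 b c" 0] by simp
  then have "cross3 (cross3 b c) (P k) = 0" by simp
  then have "cross3 (P k) (cross3 b c) = 0" by (simp add: cross_skew[of "P k"])
  then have "(P k \<bullet> c) *\<^sub>R b = 0" using b by (simp add: Lagrange)
  then show False using pos by auto
qed

end

context arrangement
begin

text \<open>Planes that meet pairwise in corners of \<open>\<sigma>\<close> bound a triangular cone.
  Evaluation at the corners shows that \<open>P a\<close> combines their normals with coefficients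
  following the signs of \<open>\<sigma>\<close>, so no point of the cone lies beyond plane
  \<open>a\<close>.\<close>

lemma corner_triangle_edges:
  assumes \<sigma>: "\<sigma> \<in> cells" and a: "a \<in> edges \<sigma>"
    and corners: "corner \<sigma> b c" "corner \<sigma> c d" "corner \<sigma> b d"
  shows "a \<in> {b, c, d}"
proof (rule ccontr)
  assume "a \<notin> {b, c, d}"
  then have ne: "a \<noteq> b" "a \<noteq> c" "a \<noteq> d" by auto
  have E: "a \<in> E" "b \<in> E" "c \<in> E" "d \<in> E" "b \<noteq> c" "c \<noteq> d" "b \<noteq> d"
    using a corners by (auto simp: edges_def corner_def)
  obtain u where u: "P b \<bullet> u = 0" "P c \<bullet> u = 0" "\<forall>m\<in>E - {b, c}. sg \<sigma> m * (P m \<bullet> u) > 0"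
    using corners(1) by (auto simp: corner_def)
  obtain v where v: "P c \<bullet> v = 0" "P d \<bullet> v = 0" "\<forall>m\<in>E - {c, d}. sg \<sigma> m * (P m \<bullet> v) > 0"
    using corners(2) by (auto simp: corner_def)
  obtain w where w: "P b \<bullet> w = 0" "P d \<bullet> w = 0" "\<forall>m\<in>E - {b, d}. sg \<sigma> m * (P m \<bullet> w) > 0"
    using corners(3) by (auto simp: corner_def)
  obtain x where x: "\<forall>i\<in>E. sg (flip a \<sigma>) i * (P i \<bullet> x) > 0"
    using flip_cell[OF a] by (auto simp: cells_iff)
  define \<Delta> where "\<Delta> = P b \<bullet> cross3 (P c) (P d)"
  \<comment> \<open>Otherwise plane \<open>d\<close> would contain the axis of \<open>b\<close> and
    \<open>c\<close>, hence the corner \<open>u\<close>.\<close>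
  have "\<Delta> \<noteq> 0"
  proof
    assume "\<Delta> = 0"
    then have "cross3 (P c) (P d) \<bullet> P b = 0" by (simp add: \<Delta>_def inner_commute)
    then have "P d \<bullet> cross3 (P b) (P c) = 0"
      by (metis cross_triple inner_commute)
    moreover obtain k where "u = k *\<^sub>R cross3 (P b) (P c)"
      using cross3_orthogonal_parallel[OF u(1,2)] cross_nonzero E by blast
    ultimately have "P d \<bullet> u = 0" by simp
    then show False using bspec[OF u(3), of d] E by simp
  qed
  define \<beta> \<gamma> \<delta> where "\<beta> = (P a \<bullet> cross3 (P c) (P d)) / \<Delta>" and "\<gamma> = (P a \<bullet> cross3 (P d) (P b)) / \<Delta>"
    and "\<delta> = (P a \<bullet> cross3 (P b) (P c)) / \<Delta>"
  have "P a = (1 / \<Delta>) *\<^sub>R (\<Delta> *\<^sub>R P a)" using \<open>\<Delta> \<noteq> 0\<close> by simp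
  also have "\<dots> = \<beta> *\<^sub>R P b + \<gamma> *\<^sub>R P c + \<delta> *\<^sub>R P d"
    unfolding \<Delta>_def by (subst cramer_cross3) (simp add: \<Delta>_def \<beta>_def \<gamma>_def \<delta>_def scaleR_add_right)
  finally have Pa: "P a \<bullet> y = \<beta> * (P b \<bullet> y) + \<gamma> * (P c \<bullet> y) + \<delta> * (P d \<bullet> y)" for y
    by (simp add: inner_add_left)
  have sign: "sg \<sigma> a * t * sg \<sigma> m > 0" if "sg \<sigma> a * (t * p) > 0" "sg \<sigma> m * p > 0" for t p m
    using that by (auto simp: sg_def zero_less_mult_iff mult_less_0_iff split: if_splits)
  have "sg \<sigma> a * (P a \<bullet> u) > 0" "sg \<sigma> d * (P d \<bullet> u) > 0" using u E ne by auto
  then have \<delta>: "sg \<sigma> a * \<delta> * sg \<sigma> d > 0" unfolding Pa using u by (intro sign) simp_all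
  have "sg \<sigma> a * (P a \<bullet> v) > 0" "sg \<sigma> b * (P b \<bullet> v) > 0" using v E ne by auto
  then have \<beta>: "sg \<sigma> a * \<beta> * sg \<sigma> b > 0" unfolding Pa using v by (intro sign) simp_all
  have "sg \<sigma> a * (P a \<bullet> w) > 0" "sg \<sigma> c * (P c \<bullet> w) > 0" using w E ne by auto
  then have \<gamma>: "sg \<sigma> a * \<gamma> * sg \<sigma> c > 0" unfolding Pa using w by (intro sign) simp_all
  have "sg \<sigma> b * (P b \<bullet> x) > 0" "sg \<sigma> c * (P c \<bullet> x) > 0" "sg \<sigma> d * (P d \<bullet> x) > 0"
    using x E ne by (force simp: sg_flip)+
  then have "(sg \<sigma> a * \<beta> * sg \<sigma> b) * (sg \<sigma> b * (P b \<bullet> x)) + (sg \<sigma> a * \<gamma> * sg \<sigma> c) * (sg \<sigma> c * (P c \<bullet> x))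
      + (sg \<sigma> a * \<delta> * sg \<sigma> d) * (sg \<sigma> d * (P d \<bullet> x)) > 0"
    using \<beta> \<gamma> \<delta> by (intro add_pos_pos mult_pos_pos[of "_ * _ * _"])
  also have "(sg \<sigma> a * \<beta> * sg \<sigma> b) * (sg \<sigma> b * (P b \<bullet> x)) + (sg \<sigma> a * \<gamma> * sg \<sigma> c) * (sg \<sigma> c * (P c \<bullet> x))
      + (sg \<sigma> a * \<delta> * sg \<sigma> d) * (sg \<sigma> d * (P d \<bullet> x)) = sg \<sigma> a * (P a \<bullet> x)"
    unfolding Pa by (simp add: algebra_simps)
  finally show False using bspec[OF x \<open>a \<in> E\<close>] by (simp add: sg_flip)
qed

lemma nbs_sym: "j \<in> nbs \<sigma> i \<longleftrightarrow> i \<in> nbs \<sigma> j"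
  using corner_sym by (auto simp: nbs_def)

lemma not_mem_nbs [simp]: "i \<notin> nbs \<sigma> i"
  by (simp add: nbs_def corner_def)

lemma edges_subset: "edges \<sigma> \<subseteq> E"
  by (auto simp: edges_def)

end

section \<open>Short lunes\<close>

text \<open>Every axis is missed by at least four planes, one more than the number of planes cutting
  any lune excluded below.\<close>

locale spread_arrangement = arrangement +
  assumes card_join: "b \<in> E \<Longrightarrow> d \<in> E \<Longrightarrow> b \<noteq> d \<Longrightarrow> card (join b d) + 4 \<le> card E"
    and card_E: "card E \<ge> 3"
begin

text \<open>The tips of the lune between \<open>b\<close> and \<open>d\<close> lie on their axis,
  and only planes in \<open>X\<close> may cut the lune. By counting, some plane outside
  \<open>X\<close> misses the tips; it passes through the origin, so it separates them and cuts the
  lune.\<close>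

lemma no_short_lune:
  assumes \<sigma>: "\<sigma> \<in> cells" and bd: "b \<in> E" "d \<in> E" "b \<noteq> d" and X: "finite X" "card X \<le> 3"
    and agree: "\<And>\<rho> j. \<rho> \<in> cells \<Longrightarrow> (b \<in> \<rho> \<longleftrightarrow> b \<in> \<sigma>) \<Longrightarrow> (d \<in> \<rho> \<longleftrightarrow> d \<in> \<sigma>) \<Longrightarrow>
      j \<in> E - X \<Longrightarrow> j \<in> \<rho> \<longleftrightarrow> j \<in> \<sigma>"
  shows False
proof -
  have "card (join b d \<union> X) \<le> card (join b d) + card X" by (rule card_Un_le)
  then have "card (join b d \<union> X) < card E" using X card_join[OF bd] by linarith
  moreover have "finite (join b d \<union> X)"
    using X(1) finite_subset[OF join_subset finite_E] by blast
  ultimately have "\<not> E \<subseteq> join b d \<union> X" using card_mono leD by metis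
  then obtain j where j: "j \<in> E - X" "P j \<bullet> cross3 (P b) (P d) \<noteq> 0"
    by (auto simp: join_def)
  have jne: "j \<noteq> b" "j \<noteq> d" using j(2) by (auto simp: dot_cross_self)
  \<comment> \<open>A point inside the lune, but across \<open>j\<close> from
    \<open>\<sigma>\<close>; a generic point with the same signs then lies in a cell.\<close>
  obtain w where w: "P j \<bullet> w = - sg \<sigma> j" "P b \<bullet> w = sg \<sigma> b" "P d \<bullet> w = sg \<sigma> d"
    using solve_three[OF j(2)] by blast
  have "0 \<notin> P ` E" using nonzero by auto
  moreover have "(P i \<bullet> w) * (P i \<bullet> w) > 0" if "i \<in> {j, b, d}" for i
    using that w by auto
  ultimately obtain y where y: "\<forall>h\<in>P ` E. h \<bullet> y \<noteq> 0"
      "\<forall>i\<in>{j, b, d}. (P i \<bullet> w) * (P i \<bullet> y) > 0"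
    using perturb_generic[of "P ` E" "{j, b, d}" "\<lambda>i. P i \<bullet> w" P w] finite_E by blast
  let ?\<rho> = "{i\<in>E. P i \<bullet> y > 0}"
  have "?\<rho> \<in> cells" unfolding cells_def using y(1) by (intro topes_positive_set) auto
  moreover have "b \<in> ?\<rho> \<longleftrightarrow> b \<in> \<sigma>" "d \<in> ?\<rho> \<longleftrightarrow> d \<in> \<sigma>" "j \<in> ?\<rho> \<longleftrightarrow> j \<notin> \<sigma>"
    using y(2) w bd j(1) by (auto simp: sg_def split: if_splits)
  ultimately show False using agree j(1) by blast
qed

text \<open>A cell determined by two planes would fill a lune that no plane cuts.\<close>

lemma card_edges_ge_3:
  assumes "\<sigma> \<in> cells"
  shows "card (edges \<sigma>) \<ge> 3"
proof (rule ccontr)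
  assume "\<not> card (edges \<sigma>) \<ge> 3"
  then obtain B where B: "edges \<sigma> \<subseteq> B" "B \<subseteq> E" "card B = 2"
    using exists_subset_between[of "edges \<sigma>" 2 E] card_E edges_subset finite_E by auto
  then obtain b d where bd: "B = {b, d}" "b \<noteq> d" by (auto simp: card_2_iff)
  have "\<rho> = \<sigma>" if "\<rho> \<in> cells" "b \<in> \<rho> \<longleftrightarrow> b \<in> \<sigma>" "d \<in> \<rho> \<longleftrightarrow> d \<in> \<sigma>" for \<rho>
    using B bd that by (intro cell_eq_if_agree_on_edges[OF assms]) auto
  then show False
    using B bd by (intro no_short_lune[OF assms, of b d "{}"]) auto
qed

section \<open>Triangles and full quadrangles stacked in a lune\<close>

abbreviation triangle :: "'a set \<Rightarrow> bool"
  where "triangle \<sigma> \<equiv> card (edges \<sigma>) = 3"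

definition full :: "'a set \<Rightarrow> bool"
  where "full \<sigma> \<longleftrightarrow> card (edges \<sigma>) = 4 \<and> (\<forall>i\<in>edges \<sigma>. card (nbs \<sigma> i) = 2)"

text \<open>For a full cell this is the opposite side; in general the two edges may still meet in a
  crossing that is not simple.\<close>

definition opposite :: "'a set \<Rightarrow> 'a \<Rightarrow> 'a \<Rightarrow> bool"
  where "opposite \<sigma> i c \<longleftrightarrow> i \<in> edges \<sigma> \<and> c \<in> edges \<sigma> \<and> c \<noteq> i \<and> c \<notin> nbs \<sigma> i"

lemma opposite_sym: "opposite \<sigma> i c \<longleftrightarrow> opposite \<sigma> c i"
  using nbs_sym by (auto simp: opposite_def)

lemma triangle_edges:
  assumes "\<tau> \<in> cells" "triangle \<tau>" "i \<in> edges \<tau>" "card (nbs \<tau> i) = 2"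
  shows "edges \<tau> = insert i (nbs \<tau> i)"
proof -
  have "finite (nbs \<tau> i)" using assms finite_nbs by blast
  then show ?thesis
    using assms nbs_subset_edges finite_edges
    by (intro card_subset_eq[symmetric]) auto
qed

lemma flipped_triangle_edges:
  assumes "\<tau> \<in> cells" "i \<in> edges \<tau>" "triangle (flip i \<tau>)" "card (nbs \<tau> i) = 2"
  shows "edges (flip i \<tau>) = insert i (nbs \<tau> i)"
  using triangle_edges[of "flip i \<tau>" i] assms flip_cell edges_flip by simp

text \<open>Two of the three other edges are neighbours of \<open>i\<close>, which leaves only
  \<open>c\<close>; the same count from \<open>c\<close> yields the same two neighbours.\<close>

lemma full_opposite:
  assumes "\<sigma> \<in> cells" "full \<sigma>" "opposite \<sigma> i c"
  shows "edges \<sigma> = insert i (insert c (nbs \<sigma> i))" "nbs \<sigma> c = nbs \<sigma> i"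
proof -
  have fin: "finite (nbs \<sigma> i)" "finite (nbs \<sigma> c)" using assms finite_nbs by auto
  show 1: "edges \<sigma> = insert i (insert c (nbs \<sigma> i))"
    using assms nbs_subset_edges finite_edges fin
    by (intro card_subset_eq[symmetric]) (auto simp: full_def opposite_def)
  have "i \<notin> nbs \<sigma> c" using assms(3) opposite_sym by (auto simp: opposite_def)
  then have "nbs \<sigma> c \<subseteq> nbs \<sigma> i"
    using nbs_subset_edges[OF assms(1), of c] 1 by auto
  then show "nbs \<sigma> c = nbs \<sigma> i"
    using fin assms by (intro card_subset_eq) (auto simp: full_def opposite_def)
qed

lemma nbs_pair:
  assumes "\<sigma> \<in> cells" "card (nbs \<sigma> i) = 2"
  obtains b d where "nbs \<sigma> i = {b, d}" "b \<noteq> d" "b \<in> E" "d \<in> E" "b \<noteq> i" "d \<noteq> i"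
proof -
  obtain b d where bd: "nbs \<sigma> i = {b, d}" "b \<noteq> d"
    using assms(2) by (auto simp: card_2_iff)
  moreover have "b \<in> E" "d \<in> E" "b \<noteq> i" "d \<noteq> i"
    using bd(1) by (auto simp: nbs_def corner_def set_eq_iff)
  ultimately show thesis by (rule that)
qed

text \<open>The other edges of both triangles lie on the same planes \<open>b\<close> and
  \<open>d\<close>, so together they fill the lune of \<open>b\<close> and \<open>d\<close>, cut by
  \<open>i\<close> alone.\<close>

lemma no_adjacent_triangles:
  assumes \<sigma>: "\<sigma> \<in> cells" "i \<in> edges \<sigma>" "card (nbs \<sigma> i) = 2" "triangle \<sigma>" "triangle (flip i \<sigma>)"
  shows False
proof -
  obtain b d where bd: "nbs \<sigma> i = {b, d}" "b \<noteq> d" "b \<in> E" "d \<in> E" "b \<noteq> i" "d \<noteq> i"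
    using nbs_pair \<sigma> by metis
  have e: "edges \<sigma> = {i, b, d}" "edges (flip i \<sigma>) = {i, b, d}"
    using triangle_edges[of \<sigma> i] flipped_triangle_edges[of \<sigma> i] \<sigma> bd(1) by simp_all
  have cover: "\<rho> = \<sigma> \<or> \<rho> = flip i \<sigma>" if "\<rho> \<in> cells" "b \<in> \<rho> \<longleftrightarrow> b \<in> \<sigma>" "d \<in> \<rho> \<longleftrightarrow> d \<in> \<sigma>" for \<rho>
  proof (cases "(i \<in> \<rho>) = (i \<in> \<sigma>)")
    case True
    then have "\<rho> = \<sigma>"
      using e that by (intro cell_eq_if_agree_on_edges[OF \<sigma>(1) that(1)]) (auto simp: mem_flip)
    then show ?thesis by simp
  next
    case False
    then have "\<rho> = flip i \<sigma>"
      using e that bd by (intro cell_eq_if_agree_on_edges[OF flip_cell[OF \<sigma>(2)] that(1)]) (auto simp: mem_flip)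
    then show ?thesis by simp
  qed
  show False
  proof (rule no_short_lune[OF \<sigma>(1) bd(3,4,2), of "{i}"])
    fix \<rho> j assume "\<rho> \<in> cells" "b \<in> \<rho> \<longleftrightarrow> b \<in> \<sigma>" "d \<in> \<rho> \<longleftrightarrow> d \<in> \<sigma>" "j \<in> E - {i}"
    then show "j \<in> \<rho> \<longleftrightarrow> j \<in> \<sigma>"
      using cover[of \<rho>] by (auto simp: mem_flip)
  qed (auto simp: card_insert_if)
qed

text \<open>A quadrangle between two triangles: three cells would fill a lune cut only by
  \<open>i\<close> and \<open>c\<close>.\<close>

lemma full_opposite_not_triangles:
  assumes \<sigma>: "\<sigma> \<in> cells" "full \<sigma>" "opposite \<sigma> i c" "triangle (flip i \<sigma>)" "triangle (flip c \<sigma>)"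
  shows False
proof -
  have ic: "i \<in> edges \<sigma>" "c \<in> edges \<sigma>" "c \<noteq> i" using \<sigma>(3) by (auto simp: opposite_def)
  then have two: "card (nbs \<sigma> i) = 2" "card (nbs \<sigma> c) = 2" using \<sigma>(2) by (auto simp: full_def)
  obtain b d where bd: "nbs \<sigma> i = {b, d}" "b \<noteq> d" "b \<in> E" "d \<in> E" "b \<noteq> i" "d \<noteq> i"
    using nbs_pair \<sigma>(1) two(1) by metis
  note fo = full_opposite[OF \<sigma>(1-3)]
  have bc: "b \<noteq> c" "d \<noteq> c" using fo(2) bd(1) not_mem_nbs[of c \<sigma>] by auto
  have e: "edges \<sigma> = {i, c, b, d}" "edges (flip i \<sigma>) = {i, b, d}" "edges (flip c \<sigma>) = {c, b, d}"
    using flipped_triangle_edges[of \<sigma> i] flipped_triangle_edges[of \<sigma> c] \<sigma> bd(1) fo two ic by simp_all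
  have cover: "\<rho> = \<sigma> \<or> \<rho> = flip i \<sigma> \<or> \<rho> = flip c \<sigma>"
    if "\<rho> \<in> cells" "b \<in> \<rho> \<longleftrightarrow> b \<in> \<sigma>" "d \<in> \<rho> \<longleftrightarrow> d \<in> \<sigma>" for \<rho>
  proof -
    consider "(c \<in> \<rho>) \<noteq> (c \<in> \<sigma>)" | "(i \<in> \<rho>) \<noteq> (i \<in> \<sigma>)"
      | "(c \<in> \<rho>) = (c \<in> \<sigma>)" "(i \<in> \<rho>) = (i \<in> \<sigma>)"
      by blast
    then show ?thesis
    proof cases
      case 1
      then have "\<rho> = flip c \<sigma>"
        using e that bc by (intro cell_eq_if_agree_on_edges[OF flip_cell[OF ic(2)] that(1)]) (auto simp: mem_flip)
      then show ?thesis by simp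
    next
      case 2
      then have "\<rho> = flip i \<sigma>"
        using e that bd by (intro cell_eq_if_agree_on_edges[OF flip_cell[OF ic(1)] that(1)]) (auto simp: mem_flip)
      then show ?thesis by simp
    next
      case 3
      then have "\<rho> = \<sigma>"
        using e that by (intro cell_eq_if_agree_on_edges[OF \<sigma>(1) that(1)]) (auto simp: mem_flip)
      then show ?thesis by simp
    qed
  qed
  show False
  proof (rule no_short_lune[OF \<sigma>(1) bd(3,4,2), of "{i, c}"])
    fix \<rho> j assume "\<rho> \<in> cells" "b \<in> \<rho> \<longleftrightarrow> b \<in> \<sigma>" "d \<in> \<rho> \<longleftrightarrow> d \<in> \<sigma>" "j \<in> E - {i, c}"
    then show "j \<in> \<rho> \<longleftrightarrow> j \<in> \<sigma>"
      using cover[of \<rho>] by (auto simp: mem_flip)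
  qed (auto simp: card_insert_if)
qed

text \<open>Two quadrangles sharing edge \<open>i\<close>, with triangles beyond \<open>c\<close>
  and \<open>e\<close>: four cells would fill a lune cut only by \<open>i\<close>, \<open>c\<close>
  and \<open>e\<close>.\<close>

lemma adjacent_full_not_capped:
  assumes \<sigma>: "\<sigma> \<in> cells" "full \<sigma>" "opposite \<sigma> i c" "triangle (flip c \<sigma>)"
    and \<tau>: "full (flip i \<sigma>)" "opposite (flip i \<sigma>) i e" "triangle (flip e (flip i \<sigma>))"
  shows False
proof -
  let ?\<tau> = "flip i \<sigma>" and ?\<upsilon> = "flip e (flip i \<sigma>)"
  have ic: "i \<in> edges \<sigma>" "c \<in> edges \<sigma>" "c \<noteq> i" using \<sigma>(3) by (auto simp: opposite_def)
  have ie: "e \<in> edges ?\<tau>" "e \<noteq> i" using \<tau>(2) by (auto simp: opposite_def)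
  have two: "card (nbs \<sigma> i) = 2" "card (nbs \<sigma> c) = 2" "card (nbs ?\<tau> e) = 2"
    using \<sigma>(2) \<tau>(1) ic ie by (auto simp: full_def)
  obtain b d where bd: "nbs \<sigma> i = {b, d}" "b \<noteq> d" "b \<in> E" "d \<in> E" "b \<noteq> i" "d \<noteq> i"
    using nbs_pair \<sigma>(1) two(1) by metis
  note fo = full_opposite[OF \<sigma>(1-3)] full_opposite[OF flip_cell[OF ic(1)] \<tau>(1,2)]
  have bc: "b \<noteq> c" "d \<noteq> c" "b \<noteq> e" "d \<noteq> e"
    using fo(2,4) bd(1) not_mem_nbs[of c \<sigma>] not_mem_nbs[of e ?\<tau>] by auto
  have cells: "?\<tau> \<in> cells" "?\<upsilon> \<in> cells" "flip c \<sigma> \<in> cells"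
    using flip_cell ic ie by auto
  have e: "edges \<sigma> = {i, c, b, d}" "edges ?\<tau> = {i, e, b, d}" "edges (flip c \<sigma>) = {c, b, d}"
      "edges ?\<upsilon> = {e, b, d}"
    using flipped_triangle_edges[of \<sigma> c] flipped_triangle_edges[of ?\<tau> e] cells \<sigma> \<tau>(3) bd(1) fo two ic ie
    by simp_all
  have cover: "\<rho> = \<sigma> \<or> \<rho> = ?\<tau> \<or> \<rho> = flip c \<sigma> \<or> \<rho> = ?\<upsilon>"
    if "\<rho> \<in> cells" "b \<in> \<rho> \<longleftrightarrow> b \<in> \<sigma>" "d \<in> \<rho> \<longleftrightarrow> d \<in> \<sigma>" for \<rho>
  proof -
    \<comment> \<open>Along the lune the cells come in the order \<open>flip c \<sigma>\<close>,
      \<open>\<sigma>\<close>, \<open>?\<tau>\<close>, \<open>?\<upsilon>\<close>, separated by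
      \<open>c\<close>, \<open>i\<close> and \<open>e\<close>; the sides of these planes locate
      \<open>\<rho>\<close>.\<close>
    consider "(c \<in> \<rho>) \<noteq> (c \<in> \<sigma>)" | "(c \<in> \<rho>) = (c \<in> \<sigma>)" "(i \<in> \<rho>) = (i \<in> \<sigma>)"
      | "(i \<in> \<rho>) \<noteq> (i \<in> \<sigma>)" "(e \<in> \<rho>) = (e \<in> \<sigma>)" | "(i \<in> \<rho>) \<noteq> (i \<in> \<sigma>)" "(e \<in> \<rho>) \<noteq> (e \<in> \<sigma>)"
      by blast
    then show ?thesis
    proof cases
      case 1
      then have "\<rho> = flip c \<sigma>"
        using e that bc by (intro cell_eq_if_agree_on_edges[OF cells(3) that(1)]) (auto simp: mem_flip)
      then show ?thesis by simp
    next
      case 2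
      then have "\<rho> = \<sigma>"
        using e that by (intro cell_eq_if_agree_on_edges[OF \<sigma>(1) that(1)]) (auto simp: mem_flip)
      then show ?thesis by simp
    next
      case 3
      then have "\<rho> = ?\<tau>"
        using e that bd ie by (intro cell_eq_if_agree_on_edges[OF cells(1) that(1)]) (auto simp: mem_flip)
      then show ?thesis by simp
    next
      case 4
      then have "\<rho> = ?\<upsilon>"
        using e that bd bc ie by (intro cell_eq_if_agree_on_edges[OF cells(2) that(1)]) (auto simp: mem_flip)
      then show ?thesis by simp
    qed
  qed
  show False
  proof (rule no_short_lune[OF \<sigma>(1) bd(3,4,2), of "{i, c, e}"])
    fix \<rho> j assume "\<rho> \<in> cells" "b \<in> \<rho> \<longleftrightarrow> b \<in> \<sigma>" "d \<in> \<rho> \<longleftrightarrow> d \<in> \<sigma>" "j \<in> E - {i, c, e}"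
    then show "j \<in> \<rho> \<longleftrightarrow> j \<in> \<sigma>"
      using cover[of \<rho>] by (auto simp: mem_flip)
  qed (auto simp: card_insert_if)
qed

end

section \<open>Discharging\<close>

context spread_arrangement
begin

text \<open>
  A quadrangle all of whose corners are simple may receive 4 across an edge from a triangle. This
  leaves it with a surplus of 1 per such triangle, which it passes on across the edge opposite to
  the triangle.
\<close>

definition push :: "'a set \<Rightarrow> 'a \<Rightarrow> bool"
  where "push \<sigma> i \<longleftrightarrow> full \<sigma> \<and> \<not> triangle (flip i \<sigma>) \<and> (\<exists>c. opposite \<sigma> i c \<and> triangle (flip c \<sigma>))"

text \<open>The amount that \<open>\<sigma>\<close> sends across edge \<open>i\<close>; it receives
  \<open>flow (flip i \<sigma>) i\<close> there.\<close>

definition flow :: "'a set \<Rightarrow> 'a \<Rightarrow> int"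
  where "flow \<sigma> i =
    (if card (nbs \<sigma> i) \<noteq> 2 then 0 else if triangle \<sigma> then 4 else if push \<sigma> i then 1 else 0)"

lemma flow_nonneg: "flow \<sigma> i \<ge> 0"
  by (simp add: flow_def)

lemma flow_le: "flow (flip i \<sigma>) i \<le> (if card (nbs \<sigma> i) = 2 then 4 else 0)"
  by (simp add: flow_def)

text \<open>Charge is conserved: crossing is an involution on pairs of a cell and one of its
  edges.\<close>

lemma sum_flow_flip:
  "(\<Sum>\<sigma>\<in>cells. \<Sum>i\<in>edges \<sigma>. flow (flip i \<sigma>) i) = (\<Sum>\<sigma>\<in>cells. \<Sum>i\<in>edges \<sigma>. flow \<sigma> i)"
proof -
  let ?S = "Sigma cells edges"
  have "(\<Sum>(\<sigma>, i)\<in>?S. flow (flip i \<sigma>) i) = (\<Sum>(\<sigma>, i)\<in>?S. flow \<sigma> i)"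
    by (rule sum.reindex_bij_witness[where i = "\<lambda>(\<sigma>, i). (flip i \<sigma>, i)" and j = "\<lambda>(\<sigma>, i). (flip i \<sigma>, i)"])
      (auto simp: flip_cell edges_flip)
  then show ?thesis
    using finite_cells finite_edges by (simp add: sum.Sigma)
qed

lemma card_nbs_eq_sum:
  assumes "\<sigma> \<in> cells"
  shows "card (nbs \<sigma> i) = (\<Sum>j\<in>edges \<sigma>. of_bool (j \<in> nbs \<sigma> i))"
proof -
  have "nbs \<sigma> i = edges \<sigma> \<inter> {j. j \<in> nbs \<sigma> i}"
    using nbs_subset_edges[OF assms] by blast
  then have "card (nbs \<sigma> i) = card (edges \<sigma> \<inter> {j. j \<in> nbs \<sigma> i})" by simp
  also have "\<dots> = (\<Sum>j\<in>edges \<sigma>. of_bool (j \<in> nbs \<sigma> i))"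
    using finite_edges by (simp add: sum_of_bool_eq)
  finally show ?thesis .
qed

text \<open>The sum of \<open>card (nbs \<sigma> i)\<close> counts every simple corner twice, once for each of its edges.\<close>

definition charge :: "'a set \<Rightarrow> int"
  where "charge \<sigma> = 50 + 2 * (\<Sum>i\<in>edges \<sigma>. int (card (nbs \<sigma> i))) - 18 * int (card (edges \<sigma>))
    + (\<Sum>i\<in>edges \<sigma>. flow (flip i \<sigma>) i - flow \<sigma> i)"

text \<open>With \<open>d\<close> simple corners the initial charge is \<open>4 * d - 4\<close>. For
  \<open>d = 2\<close> one edge joins simple corners, for \<open>d = 3\<close> all three do, and
  each of these sends 4.\<close>

lemma charge_triangle:
  assumes \<sigma>: "\<sigma> \<in> cells" "triangle \<sigma>"
  shows "charge \<sigma> \<le> 0"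
proof -
  obtain a b c where e: "edges \<sigma> = {a, b, c}" "a \<noteq> b" "b \<noteq> c" "a \<noteq> c"
    using \<sigma>(2) by (auto simp: card_3_iff)
  \<comment> \<open>Nothing is received: there is no triangle across an edge with two simple
    corners, and \<open>push\<close> never leads into a triangle.\<close>
  have "flow (flip i \<sigma>) i - flow \<sigma> i = - (if card (nbs \<sigma> i) = 2 then 4 else 0)"
    if "i \<in> edges \<sigma>" for i
    using no_adjacent_triangles[OF \<sigma>(1) that _ \<sigma>(2)] \<sigma>(2) by (auto simp: flow_def push_def)
  then have *: "charge \<sigma> = 50 + 2 * (\<Sum>i\<in>edges \<sigma>. int (card (nbs \<sigma> i))) - 54
      + (\<Sum>i\<in>edges \<sigma>. - (if card (nbs \<sigma> i) = 2 then 4 else 0))"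
    unfolding charge_def using \<sigma>(2) by simp
  show ?thesis
    unfolding * card_nbs_eq_sum[OF \<sigma>(1)] e
    using e(2-4) nbs_sym[of a \<sigma> b] nbs_sym[of a \<sigma> c] nbs_sym[of b \<sigma> c] by (simp add: of_bool_def)
qed

text \<open>For \<open>k\<close> edges the charge is at most
  \<open>50 + 4 * k - 18 * k + 4 * k = 50 - 10 * k\<close>, which is 0 at
  \<open>k = 5\<close>.\<close>

lemma charge_large:
  assumes \<sigma>: "\<sigma> \<in> cells" "card (edges \<sigma>) \<ge> 5"
  shows "charge \<sigma> \<le> 0"
proof -
  have "(\<Sum>i\<in>edges \<sigma>. flow (flip i \<sigma>) i - flow \<sigma> i) \<le> of_nat (card (edges \<sigma>)) * 4"
  proof (rule sum_bounded_above)
    show "flow (flip i \<sigma>) i - flow \<sigma> i \<le> 4" for i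
      using flow_le[of i \<sigma>] flow_nonneg[of \<sigma> i] by (auto split: if_splits)
  qed
  moreover have "(\<Sum>i\<in>edges \<sigma>. int (card (nbs \<sigma> i))) \<le> of_nat (card (edges \<sigma>)) * 2"
    using card_nbs_le_2[OF \<sigma>(1)] by (intro sum_bounded_above) (simp flip: of_nat_le_iff)
  ultimately show ?thesis using \<sigma>(2) by (simp add: charge_def)
qed

text \<open>The simple corners form a graph on the four edges. Once the 4-cycle and triangles are
  excluded, the worst case is a path through all four, of value 20, whereas a triangle would give
  24. The bound is \<open>18 * 4 - 50 = 22\<close>.\<close>

lemma quad_degrees:
  fixes ab ac ad bc bd cd :: bool and da db dc dd :: nat
  assumes "da = of_bool ab + of_bool ac + of_bool ad" "db = of_bool ab + of_bool bc + of_bool bd"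
    "dc = of_bool ac + of_bool bc + of_bool cd" "dd = of_bool ad + of_bool bd + of_bool cd"
    and "da \<le> 2" "db \<le> 2" "dc \<le> 2" "dd \<le> 2" "\<not> (da = 2 \<and> db = 2 \<and> dc = 2 \<and> dd = 2)"
    and "\<not> (ab \<and> bc \<and> ac)" "\<not> (ab \<and> bd \<and> ad)" "\<not> (ac \<and> cd \<and> ad)" "\<not> (bc \<and> cd \<and> bd)"
  shows "2 * (int da + int db + int dc + int dd) + (if da = 2 then 4 else 0) + (if db = 2 then 4 else 0)
    + (if dc = 2 then 4 else 0) + (if dd = 2 then 4 else 0) \<le> 22"
  using assms by (cases ab; cases ac; cases ad; cases bc; cases bd; cases cd) simp_all

lemma charge_quad:
  assumes \<sigma>: "\<sigma> \<in> cells" "card (edges \<sigma>) = 4" "\<not> full \<sigma>"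
  shows "charge \<sigma> \<le> 0"
proof -
  obtain a b c d where e: "edges \<sigma> = {a, b, c, d}" "distinct [a, b, c, d]"
    using \<sigma>(2) by (auto simp: card_Suc_eq numeral_eq_Suc)
  have tri: "\<not> (x \<in> nbs \<sigma> y \<and> y \<in> nbs \<sigma> z \<and> x \<in> nbs \<sigma> z)" if "w \<in> edges \<sigma>" "w \<notin> {x, y, z}" for w x y z
    using corner_triangle_edges[OF \<sigma>(1) that(1), of z y x] that(2) by (auto simp: nbs_def)
  let ?h = "\<lambda>i. if card (nbs \<sigma> i) = 2 then 4 else 0 :: int"
  have "(\<Sum>i\<in>edges \<sigma>. flow (flip i \<sigma>) i - flow \<sigma> i) \<le> (\<Sum>i\<in>edges \<sigma>. ?h i)"
    using flow_le flow_nonneg by (intro sum_mono) (smt (verit))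
  then have *: "charge \<sigma> \<le> 2 * (\<Sum>i\<in>edges \<sigma>. int (card (nbs \<sigma> i))) + (\<Sum>i\<in>edges \<sigma>. ?h i) - 22"
    unfolding charge_def using \<sigma>(2) by simp
  have four: "(\<Sum>i\<in>edges \<sigma>. f i) = f a + f b + f c + f d" for f :: "'a \<Rightarrow> 'b::comm_monoid_add"
    using e(2) by (simp add: e(1) add.assoc)
  have nf: "\<not> (\<forall>i\<in>edges \<sigma>. card (nbs \<sigma> i) = 2)" using \<sigma> by (simp add: full_def)
  have le2: "card (nbs \<sigma> i) \<le> 2" for i using card_nbs_le_2[OF \<sigma>(1)] by simp
  have T: "\<not> (b \<in> nbs \<sigma> a \<and> c \<in> nbs \<sigma> b \<and> c \<in> nbs \<sigma> a)" "\<not> (b \<in> nbs \<sigma> a \<and> d \<in> nbs \<sigma> b \<and> d \<in> nbs \<sigma> a)"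
    "\<not> (c \<in> nbs \<sigma> a \<and> d \<in> nbs \<sigma> c \<and> d \<in> nbs \<sigma> a)" "\<not> (c \<in> nbs \<sigma> b \<and> d \<in> nbs \<sigma> c \<and> d \<in> nbs \<sigma> b)"
    using tri[of d c b a] tri[of c d b a] tri[of b d c a] tri[of a d c b] e by auto
  note deg = card_nbs_eq_sum[OF \<sigma>(1), unfolded four]
  have "2 * (int (card (nbs \<sigma> a)) + int (card (nbs \<sigma> b)) + int (card (nbs \<sigma> c)) + int (card (nbs \<sigma> d)))
      + ?h a + ?h b + ?h c + ?h d \<le> 22"
  proof (rule quad_degrees[OF _ _ _ _ le2 le2 le2 le2 _ T])
    show "card (nbs \<sigma> a) = of_bool (b \<in> nbs \<sigma> a) + of_bool (c \<in> nbs \<sigma> a) + of_bool (d \<in> nbs \<sigma> a)"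
      "card (nbs \<sigma> b) = of_bool (b \<in> nbs \<sigma> a) + of_bool (c \<in> nbs \<sigma> b) + of_bool (d \<in> nbs \<sigma> b)"
      "card (nbs \<sigma> c) = of_bool (c \<in> nbs \<sigma> a) + of_bool (c \<in> nbs \<sigma> b) + of_bool (d \<in> nbs \<sigma> c)"
      "card (nbs \<sigma> d) = of_bool (d \<in> nbs \<sigma> a) + of_bool (d \<in> nbs \<sigma> b) + of_bool (d \<in> nbs \<sigma> c)"
      unfolding deg using nbs_sym[of a \<sigma>] nbs_sym[of b \<sigma> c] nbs_sym[of b \<sigma> d] nbs_sym[of c \<sigma> d]
      by simp_all
    show "\<not> (card (nbs \<sigma> a) = 2 \<and> card (nbs \<sigma> b) = 2 \<and> card (nbs \<sigma> c) = 2 \<and> card (nbs \<sigma> d) = 2)"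
      using nf e(1) by auto
  qed
  then show ?thesis using * unfolding four by linarith
qed

text \<open>A triangle beyond \<open>i\<close> brings at most 4, and 1 leaves across
  \<open>c\<close>. Nothing enters across \<open>c\<close>: a triangle or a pushing quadrangle there
  would complete a short lune. Without triangles each side brings at most 1.\<close>

lemma flow_opposite_pair:
  assumes \<sigma>: "\<sigma> \<in> cells" "full \<sigma>" "opposite \<sigma> i c"
  shows "(flow (flip i \<sigma>) i - flow \<sigma> i) + (flow (flip c \<sigma>) c - flow \<sigma> c) \<le> 3"
proof -
  have one_sided: "(flow (flip i \<sigma>) i - flow \<sigma> i) + (flow (flip c \<sigma>) c - flow \<sigma> c) \<le> 3"
    if opp: "opposite \<sigma> i c" and tri: "triangle (flip i \<sigma>)" for i c
  proof -
    have ntri: "\<not> triangle (flip c \<sigma>)" using full_opposite_not_triangles[OF \<sigma>(1,2) opp tri] by blast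
    have opp': "opposite \<sigma> c i" using opp opposite_sym by blast
    have "\<not> push (flip c \<sigma>) c"
      using adjacent_full_not_capped[OF \<sigma>(1,2) opp' tri] unfolding push_def by blast
    moreover have "push \<sigma> c" unfolding push_def using \<sigma>(2) ntri opp' tri by blast
    moreover have "card (nbs \<sigma> c) = 2" "\<not> triangle \<sigma>"
      using \<sigma>(2) opp by (auto simp: full_def opposite_def)
    ultimately have "flow (flip c \<sigma>) c = 0" "flow \<sigma> c = 1" using ntri by (auto simp: flow_def)
    then show ?thesis using flow_le[of i \<sigma>] flow_nonneg[of \<sigma> i] by (auto split: if_splits)
  qed
  show ?thesis
  proof (cases "triangle (flip i \<sigma>) \<or> triangle (flip c \<sigma>)")
    case True
    then show ?thesis using one_sided[of i c] one_sided[of c i] \<sigma>(3) opposite_sym by fastforce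
  next
    case False
    then have "flow (flip i \<sigma>) i \<le> 1" "flow (flip c \<sigma>) c \<le> 1" by (auto simp: flow_def)
    then show ?thesis using flow_nonneg[of \<sigma> i] flow_nonneg[of \<sigma> c] by simp
  qed
qed

text \<open>The initial charge is \<open>50 + 16 - 72 = - 6\<close>, and each of the two pairs of
  opposite edges adds at most 3.\<close>

lemma charge_full:
  assumes \<sigma>: "\<sigma> \<in> cells" "full \<sigma>"
  shows "charge \<sigma> \<le> 0"
proof -
  have c4: "card (edges \<sigma>) = 4" and two: "\<And>i. i \<in> edges \<sigma> \<Longrightarrow> card (nbs \<sigma> i) = 2"
    using \<sigma>(2) by (auto simp: full_def)
  obtain i where i: "i \<in> edges \<sigma>" using c4 by fastforce
  obtain b d where bd: "nbs \<sigma> i = {b, d}" "b \<noteq> d" "b \<noteq> i" "d \<noteq> i"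
    using nbs_pair \<sigma>(1) two[OF i] by metis
  have bdE: "b \<in> edges \<sigma>" "d \<in> edges \<sigma>" using nbs_subset_edges[OF \<sigma>(1), of i] bd(1) by auto
  have "\<not> edges \<sigma> \<subseteq> {i, b, d}"
  proof
    assume "edges \<sigma> \<subseteq> {i, b, d}"
    then have "card (edges \<sigma>) \<le> card {i, b, d}" by (intro card_mono) auto
    then show False using c4 by (simp add: card_insert_if split: if_splits)
  qed
  then obtain c where c: "c \<in> edges \<sigma>" "c \<noteq> i" "c \<noteq> b" "c \<noteq> d" by blast
  have opp: "opposite \<sigma> i c" using i c bd(1) by (auto simp: opposite_def)
  note fo = full_opposite[OF \<sigma> opp]
  have "{i, c} \<subseteq> nbs \<sigma> b"
    using fo(2) bd(1) nbs_sym[of i \<sigma> b] nbs_sym[of c \<sigma> b] by auto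
  then have "nbs \<sigma> b = {i, c}"
    using two[OF bdE(1)] c(2) finite_nbs[OF \<sigma>(1)] by (intro card_subset_eq[symmetric]) auto
  then have opp': "opposite \<sigma> b d" using bdE bd c by (auto simp: opposite_def)
  have e: "edges \<sigma> = {i, c, b, d}" using fo(1) bd(1) by simp
  have "(\<Sum>j\<in>edges \<sigma>. flow (flip j \<sigma>) j - flow \<sigma> j) \<le> 6"
    using flow_opposite_pair[OF \<sigma> opp] flow_opposite_pair[OF \<sigma> opp'] c bd by (simp add: e)
  moreover have "(\<Sum>j\<in>edges \<sigma>. int (card (nbs \<sigma> j))) = 8" using two c4 by simp
  ultimately show ?thesis by (simp add: charge_def c4)
qed

lemma discharging:
  "50 * card cells + 2 * (\<Sum>\<sigma>\<in>cells. \<Sum>i\<in>edges \<sigma>. card (nbs \<sigma> i)) \<le> 18 * (\<Sum>\<sigma>\<in>cells. card (edges \<sigma>))"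
proof -
  have "charge \<sigma> \<le> 0" if \<sigma>: "\<sigma> \<in> cells" for \<sigma>
  proof -
    consider "triangle \<sigma>" | "card (edges \<sigma>) = 4" "full \<sigma>" | "card (edges \<sigma>) = 4" "\<not> full \<sigma>"
      | "card (edges \<sigma>) \<ge> 5"
      using card_edges_ge_3[OF \<sigma>] by linarith
    then show ?thesis
      using charge_triangle charge_full charge_quad charge_large \<sigma> by cases auto
  qed
  then have "(\<Sum>\<sigma>\<in>cells. charge \<sigma>) \<le> 0" by (rule sum_nonpos)
  moreover have "(\<Sum>\<sigma>\<in>cells. charge \<sigma>) = 50 * int (card cells)
      + 2 * (\<Sum>\<sigma>\<in>cells. \<Sum>i\<in>edges \<sigma>. int (card (nbs \<sigma> i))) - 18 * (\<Sum>\<sigma>\<in>cells. int (card (edges \<sigma>)))"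
    using sum_flow_flip
    by (simp add: charge_def sum.distrib sum_subtractf sum_distrib_left)
  ultimately have "int (50 * card cells + 2 * (\<Sum>\<sigma>\<in>cells. \<Sum>i\<in>edges \<sigma>. card (nbs \<sigma> i)))
      \<le> int (18 * (\<Sum>\<sigma>\<in>cells. card (edges \<sigma>)))"
    by simp
  then show ?thesis by (simp only: of_nat_le_iff)
qed

section \<open>Counting cells, edges and simple corners\<close>

lemma card_cells: "card cells = 2 + 2 * (\<Sum>L\<in>joins. card L - 1)"
proof -
  have "L \<inter> E = L" if "L \<in> joins" for L
    using that join_subset by (auto simp: joins_def)
  moreover have "E \<noteq> {}" using card_E by auto
  ultimately show ?thesis unfolding cells_def by (simp add: card_topes_UNIV)
qed

text \<open>Plane \<open>i\<close> has two sectors per join through \<open>i\<close>, and each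
  sector borders one cell on either side.\<close>

lemma card_cells_at_edge:
  assumes i: "i \<in> E"
  shows "card {\<sigma> \<in> cells. flip i \<sigma> \<in> cells} = 4 * card {L \<in> joins. i \<in> L}"
proof -
  let ?A = "E - {i}"
  define R where "R = topes P ?A (plane i)"
  have R: "R = {\<sigma>. \<sigma> \<subseteq> ?A \<and> \<sigma> \<in> cells \<and> insert i \<sigma> \<in> cells}"
    using topes_hyperplane[of ?A i UNIV "P i" P] finite_E nonzero[OF i] i
    by (simp add: R_def cells_def insert_absorb)
  have "?A \<noteq> {}" using card_E card_mono[of "{i}" E] by auto
  then have cR: "card R = 2 * card {L \<in> joins. i \<in> L \<and> L \<inter> ?A \<noteq> {}}"
    unfolding R_def using i by (intro card_topes_plane) auto
  have "L \<inter> ?A \<noteq> {}" if L: "L \<in> joins" for L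
  proof -
    obtain a b where "L = join a b" "a \<in> E" "b \<in> E" "a \<noteq> b" using L by (auto simp: joins_def)
    then show ?thesis using mem_join[of a b] mem_join[of b a] by blast
  qed
  then have "{L \<in> joins. i \<in> L \<and> L \<inter> ?A \<noteq> {}} = {L \<in> joins. i \<in> L}" by blast
  note cR = cR[unfolded this]
  have fin: "finite R" unfolding R_def using finite_E by (simp add: finite_topes)
  have "{\<sigma> \<in> cells. flip i \<sigma> \<in> cells} = R \<union> insert i ` R"
  proof (intro equalityI subsetI)
    fix \<sigma> assume \<sigma>: "\<sigma> \<in> {\<sigma> \<in> cells. flip i \<sigma> \<in> cells}"
    show "\<sigma> \<in> R \<union> insert i ` R"
    proof (cases "i \<in> \<sigma>")
      case True
      then have "\<sigma> - {i} \<in> R" "\<sigma> = insert i (\<sigma> - {i})"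
        using \<sigma> by (auto simp: R flip_def insert_absorb cells_iff)
      then show ?thesis by blast
    next
      case False
      then have "\<sigma> \<in> R" using \<sigma> by (auto simp: R flip_def cells_iff)
      then show ?thesis by blast
    qed
  next
    fix \<sigma> assume "\<sigma> \<in> R \<union> insert i ` R"
    then consider "\<sigma> \<in> R" | \<tau> where "\<tau> \<in> R" "\<sigma> = insert i \<tau>" by blast
    then show "\<sigma> \<in> {\<sigma> \<in> cells. flip i \<sigma> \<in> cells}"
    proof cases
      case 1
      then have "i \<notin> \<sigma>" by (auto simp: R)
      then show ?thesis using 1 by (simp add: R flip_def)
    next
      case 2
      then have "\<sigma> - {i} = \<tau>" by (auto simp: R)
      then show ?thesis using 2 by (simp add: R flip_def)
    qed
  qed
  moreover have "R \<inter> insert i ` R = {}" by (auto simp: R)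
  moreover have "card (insert i ` R) = card R"
    by (intro card_image inj_onI) (auto simp: R)
  ultimately show ?thesis using fin cR by (simp add: card_Un_disjoint)
qed

lemma sum_card_edges: "(\<Sum>\<sigma>\<in>cells. card (edges \<sigma>)) = 4 * (\<Sum>L\<in>joins. card L)"
proof -
  have JE: "L \<subseteq> E" if "L \<in> joins" for L
    using that join_subset by (auto simp: joins_def)
  have "(\<Sum>\<sigma>\<in>cells. card (edges \<sigma>)) = (\<Sum>\<sigma>\<in>cells. \<Sum>i\<in>E. of_bool (flip i \<sigma> \<in> cells))"
    using finite_E by (simp add: edges_def sum_of_bool_eq Int_def)
  also have "\<dots> = (\<Sum>i\<in>E. \<Sum>\<sigma>\<in>cells. of_bool (flip i \<sigma> \<in> cells))" by (rule sum.swap)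
  also have "\<dots> = (\<Sum>i\<in>E. card {\<sigma> \<in> cells. flip i \<sigma> \<in> cells})"
    using finite_cells by (simp add: sum_of_bool_eq Int_def)
  also have "\<dots> = 4 * (\<Sum>i\<in>E. card {L \<in> joins. i \<in> L})"
    by (simp add: card_cells_at_edge sum_distrib_left)
  also have "(\<Sum>i\<in>E. card {L \<in> joins. i \<in> L}) = (\<Sum>i\<in>E. \<Sum>L\<in>joins. of_bool (i \<in> L))"
    using finite_joins by (simp add: sum_of_bool_eq Int_def)
  also have "\<dots> = (\<Sum>L\<in>joins. \<Sum>i\<in>E. of_bool (i \<in> L))" by (rule sum.swap)
  also have "\<dots> = (\<Sum>L\<in>joins. card L)"
    using finite_E JE by (intro sum.cong) (simp_all add: sum_of_bool_eq Int_absorb1)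
  finally show ?thesis .
qed

text \<open>The axis has two rays with four cells around each: \<open>R\<close> holds the signs of
  the rays at the other planes, and the subsets of \<open>{i, j}\<close> give the four
  positions.\<close>

lemma card_cells_at_simple_corner:
  assumes ij: "i \<in> E" "j \<in> E" "i \<noteq> j" and simple: "join i j = {i, j}"
  shows "card {\<sigma> \<in> cells. corner \<sigma> i j} \<ge> 8"
proof -
  let ?A = "E - {i, j}"
  define R where "R = topes P ?A (plane i \<inter> plane j)"
  have "card {i, j} = 2" using ij by simp
  then have "?A \<noteq> {}" using card_E card_mono[of "{i, j}" E] by fastforce
  moreover have "\<not> (\<exists>k\<in>?A. P k \<bullet> cross3 (P i) (P j) = 0)"
    using simple by (auto simp: join_def)
  ultimately have "card R = 2"
    unfolding R_def using card_topes_axis[OF ij, of ?A] finite_E by simp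
  let ?f = "\<lambda>(\<tau>, s). \<tau> \<union> s"
  have "inj_on ?f (R \<times> Pow {i, j})"
    by (intro inj_onI) (auto simp: R_def topes_def)
  then have "card (?f ` (R \<times> Pow {i, j})) = card R * card (Pow {i, j})"
    by (simp add: card_image card_cartesian_product)
  also have "\<dots> = 8" using \<open>card R = 2\<close> ij by (simp add: card_Pow)
  finally have "8 = card (?f ` (R \<times> Pow {i, j}))" by simp
  also have "\<dots> \<le> card {\<sigma> \<in> cells. corner \<sigma> i j}"
  proof (intro card_mono)
    show "finite {\<sigma> \<in> cells. corner \<sigma> i j}" using finite_cells by simp
    have "\<tau> \<union> s \<in> cells \<and> corner (\<tau> \<union> s) i j" if \<tau>: "\<tau> \<in> R" and s: "s \<subseteq> {i, j}" for \<tau> s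
    proof -
      obtain v where v: "P i \<bullet> v = 0" "P j \<bullet> v = 0" "\<forall>k\<in>?A. sg \<tau> k * (P k \<bullet> v) > 0" and sub: "\<tau> \<subseteq> ?A"
        using \<tau> by (auto simp: R_def topes_def)
      have "sg (\<tau> \<union> s) k = sg \<tau> k" if "k \<in> ?A" for k
        using that s by (intro sg_cong) auto
      then have c: "corner (\<tau> \<union> s) i j" unfolding corner_def using ij v by auto
      have "\<tau> \<union> s \<subseteq> E" using sub s ij by auto
      then show ?thesis using c corner_cells by blast
    qed
    then show "?f ` (R \<times> Pow {i, j}) \<subseteq> {\<sigma> \<in> cells. corner \<sigma> i j}" by auto
  qed
  finally show ?thesis .
qed

abbreviation pairs :: "'a set \<Rightarrow> ('a \<times> 'a) set"
  where "pairs L \<equiv> L \<times> L - Id"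

lemma card_pairs: "finite L \<Longrightarrow> card (pairs L) = card L * (card L - 1)"
proof -
  assume "finite L"
  have "pairs L = L \<times> L - (\<lambda>x. (x, x)) ` L" by auto
  moreover have "card ((\<lambda>x. (x, x)) ` L) = card L" by (intro card_image inj_onI) auto
  ultimately have "card (pairs L) = card L * card L - card L"
    using \<open>finite L\<close> card_Diff_subset[of "(\<lambda>x. (x, x)) ` L" "L \<times> L"]
    by (auto simp: card_cartesian_product)
  then show ?thesis by (simp add: diff_mult_distrib2)
qed

lemma finite_join: "L \<in> joins \<Longrightarrow> finite L"
  using join_subset finite_E finite_subset unfolding joins_def by blast

lemma card_UN_pairs:
  assumes "K \<subseteq> joins"
  shows "card (\<Union>L\<in>K. pairs L) = (\<Sum>L\<in>K. card L * (card L - 1))"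
proof -
  have "card (\<Union>L\<in>K. pairs L) = (\<Sum>L\<in>K. card (pairs L))"
  proof (intro card_UN_disjoint ballI impI)
    show "finite K" using assms finite_joins finite_subset by blast
    show "finite (pairs L)" if "L \<in> K" for L using that assms finite_join by blast
    show "pairs L \<inter> pairs M = {}" if "L \<in> K" "M \<in> K" "L \<noteq> M" for L M
    proof -
      have "L = M" if "a \<in> L" "b \<in> L" "a \<in> M" "b \<in> M" "a \<noteq> b" for a b
        using that joins_eqI[of L a b] joins_eqI[of M a b] \<open>L \<in> K\<close> \<open>M \<in> K\<close> assms by auto
      then show ?thesis using \<open>L \<noteq> M\<close> by auto
    qed
  qed
  then show ?thesis using assms finite_join by (simp add: card_pairs subset_iff)
qed

text \<open>Each join of size 2 yields two ordered pairs, and each pair is a corner of at least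
  eight cells.\<close>

lemma sum_card_nbs_ge:
  "(\<Sum>\<sigma>\<in>cells. \<Sum>i\<in>edges \<sigma>. card (nbs \<sigma> i)) \<ge> 16 * card {L \<in> joins. card L = 2}"
proof -
  let ?K = "{L \<in> joins. card L = 2}"
  let ?S = "\<Union>L\<in>?K. pairs L"
  have fS: "finite ?S" using finite_joins finite_join by auto
  have S: "i \<in> E \<and> j \<in> E \<and> i \<noteq> j \<and> join i j = {i, j}" if ij: "(i, j) \<in> ?S" for i j
  proof -
    obtain L where L: "L \<in> joins" "card L = 2" "i \<in> L" "j \<in> L" "i \<noteq> j" using ij by auto
    moreover have "L = {i, j}" using L by (auto simp: card_2_iff)
    ultimately show ?thesis using joins_eqI[of L i j] join_subset by (auto simp: joins_def)
  qed
  have "card ?S = (\<Sum>L\<in>?K. card L * (card L - 1))" by (rule card_UN_pairs) auto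
  also have "\<dots> = (\<Sum>L\<in>?K. 2)" by (rule sum.cong) auto
  finally have "16 * card ?K = 8 * card ?S" by simp
  also have "\<dots> = (\<Sum>(i, j)\<in>?S. 8)" by simp
  also have "\<dots> \<le> (\<Sum>(i, j)\<in>?S. card {\<sigma> \<in> cells. corner \<sigma> i j})"
  proof (rule sum_mono)
    fix x assume "x \<in> ?S"
    then show "(case x of (i, j) \<Rightarrow> 8) \<le> (case x of (i, j) \<Rightarrow> card {\<sigma> \<in> cells. corner \<sigma> i j})"
      using S[of "fst x" "snd x"] card_cells_at_simple_corner[of "fst x" "snd x"]
      by (simp add: case_prod_beta)
  qed
  also have "\<dots> = (\<Sum>(i, j)\<in>?S. \<Sum>\<sigma>\<in>cells. of_bool (corner \<sigma> i j))"
    using finite_cells by (simp add: sum_of_bool_eq Int_def)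
  also have "\<dots> = (\<Sum>\<sigma>\<in>cells. \<Sum>(i, j)\<in>?S. of_bool (corner \<sigma> i j))"
    unfolding case_prod_beta by (rule sum.swap)
  also have "\<dots> \<le> (\<Sum>\<sigma>\<in>cells. \<Sum>i\<in>edges \<sigma>. card (nbs \<sigma> i))"
  proof (intro sum_mono)
    fix \<sigma> assume \<sigma>: "\<sigma> \<in> cells"
    have "(\<Sum>(i, j)\<in>?S. of_bool (corner \<sigma> i j)) = card (?S \<inter> {(i, j). corner \<sigma> i j})"
      using fS by (simp add: sum_of_bool_eq case_prod_unfold)
    also have "\<dots> \<le> card (Sigma (edges \<sigma>) (nbs \<sigma>))"
      using \<sigma> finite_edges finite_nbs corner_edges by (intro card_mono) (auto simp: nbs_def cells_iff)
    also have "\<dots> = (\<Sum>i\<in>edges \<sigma>. card (nbs \<sigma> i))"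
      using finite_edges finite_nbs[OF \<sigma>] by simp
    finally show "(\<Sum>(i, j)\<in>?S. of_bool (corner \<sigma> i j)) \<le> (\<Sum>i\<in>edges \<sigma>. card (nbs \<sigma> i))" .
  qed
  finally show ?thesis .
qed

section \<open>The inequality for the joins and the numerical contradiction\<close>

lemma join_inequality:
  "100 + 100 * (\<Sum>L\<in>joins. card L - 1) + 32 * card {L \<in> joins. card L = 2} \<le> 72 * (\<Sum>L\<in>joins. card L)"
  \<comment> \<open>If all joins have size at most 4, sorting them by size and dividing by 4 turns
    this into \<open>3 t\<^sub>2 + 4 t\<^sub>3 \<ge> 25 + 3 t\<^sub>4\<close>.\<close>
  using discharging sum_card_nbs_ge by (simp add: card_cells sum_card_edges)

lemma sum_pairs_joins: "(\<Sum>L\<in>joins. card L * (card L - 1)) = card E * (card E - 1)"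
proof -
  have "(\<Union>L\<in>joins. pairs L) = pairs E"
  proof (intro equalityI subsetI)
    fix x assume x: "x \<in> pairs E"
    obtain i j where ij: "x = (i, j)" by (cases x)
    then have "i \<in> E" "j \<in> E" "i \<noteq> j" using x by auto
    then have "join i j \<in> joins" "x \<in> pairs (join i j)" using ij join_in_joins by auto
    then show "x \<in> (\<Union>L\<in>joins. pairs L)" by blast
  qed (use join_subset in \<open>auto simp: joins_def\<close>)
  then show ?thesis using card_UN_pairs[of joins] card_pairs[OF finite_E] by simp
qed

theorem no_sixteen_joins_of_card_4:
  assumes "card E = 16" "\<And>L. L \<in> joins \<Longrightarrow> card L \<le> 4" "card {L \<in> joins. card L = 4} = 16"
  shows False
proof -
  have ge2: "card L \<ge> 2" if L: "L \<in> joins" for L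
  proof -
    obtain a b where "L = join a b" "a \<in> E" "b \<in> E" "a \<noteq> b" using L by (auto simp: joins_def)
    then have "card {a, b} \<le> card L" using L finite_join by (intro card_mono) auto
    then show ?thesis using \<open>a \<noteq> b\<close> by simp
  qed
  \<comment> \<open>The weight 6 on pairs gives equality at size 2, \<open>132 + 12 = 144\<close>,
    and 84 is then the surplus at size 4, \<open>300 + 72 - 288\<close>.\<close>
  have pointwise: "100 * (card L - 1) + 32 * of_bool (card L = 2) + 6 * (card L * (card L - 1))
      \<ge> 72 * card L + 84 * of_bool (card L = 4)" if L: "L \<in> joins" for L
  proof -
    consider "card L = 2" | "card L = 3" | "card L = 4" using ge2[OF L] assms(2)[OF L] by linarith
    then show ?thesis by cases simp_all
  qed
  have "(\<Sum>L\<in>joins. 72 * card L + 84 * of_bool (card L = 4)) \<le>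
      (\<Sum>L\<in>joins. 100 * (card L - 1) + 32 * of_bool (card L = 2) + 6 * (card L * (card L - 1)))"
    using pointwise by (rule sum_mono)
  then have "72 * (\<Sum>L\<in>joins. card L) + 84 * card {L \<in> joins. card L = 4} \<le>
      100 * (\<Sum>L\<in>joins. card L - 1) + 32 * card {L \<in> joins. card L = 2}
      + 6 * (\<Sum>L\<in>joins. card L * (card L - 1))"
    using finite_joins by (simp add: sum.distrib Int_def flip: sum_distrib_left)
  \<comment> \<open>The pairs of 16 points supply \<open>6 * 240 = 1440\<close>, but the joins of
    size 4 and the constant of \<open>join_inequality\<close> require
    \<open>84 * 16 + 100 = 1444\<close>.\<close>
  then show False
    using join_inequality sum_pairs_joins by (simp add: assms)
qed

end

section \<open>Configurations\<close>

context matroid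
begin

lemma finite_card_indep: "finite {card I | I. I \<subseteq> X \<and> indep I}"
  by (rule finite_subset[of _ "card ` Pow E"]) (use finite_ground indep_subset in auto)

lemma card_le_rank: "I \<subseteq> X \<Longrightarrow> indep I \<Longrightarrow> card I \<le> rank X"
  unfolding rank_def using finite_card_indep by (intro Max_ge) auto

lemma rank_attained: "\<exists>I\<subseteq>X. indep I \<and> card I = rank X"
proof -
  have "{card I | I. I \<subseteq> X \<and> indep I} \<noteq> {}" using indep_empty by blast
  from Max_in[OF finite_card_indep this] show ?thesis unfolding rank_def by auto
qed

lemma simple_indep_pair:
  assumes "simple" "i \<in> E" "j \<in> E" "i \<noteq> j"
  shows "indep {i, j}"
  using assms unfolding simple_def parallel_def by blast

end

section \<open>From a realized configuration to its arrangement\<close>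

theorem theorem2:
  shows "\<not> (\<exists>(E :: 'a set) indep. configuration_16_4 E indep \<and> matroid.realizable E indep)"
proof
  assume "\<exists>(E :: 'a set) indep. configuration_16_4 E indep \<and> matroid.realizable E indep"
  then obtain E :: "'a set" and indep where conf: "configuration_16_4 E indep"
    and real: "matroid.realizable E indep" by blast
  interpret configuration_16_4 E indep by (rule conf)
  obtain p :: "'a \<Rightarrow> (real ^ 3) set" where inj: "inj_on p E" and p: "p ` E \<subseteq> proj_points"
    and coll: "\<And>S. S \<subseteq> E \<Longrightarrow> proj_collinear (p ` S) \<longleftrightarrow> rank S \<le> 2"
    using real unfolding realizable_def by blast
  have "\<exists>v. v \<noteq> 0 \<and> p i = span {v}" if "i \<in> E" for i
  proof -
    have *: "subspace (p i)" "dim (p i) = 1" using p that by (auto simp: proj_points_def)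
    then obtain B where "B \<subseteq> p i" "independent B" "p i \<subseteq> span B" "card B = 1"
      using basis_exists[of "p i"] by auto
    moreover from this obtain v where "B = {v}" by (auto simp: card_1_singleton_iff)
    ultimately show ?thesis using span_minimal[of B "p i"] *(1) by auto
  qed
  then obtain P where P: "\<And>i. i \<in> E \<Longrightarrow> P i \<noteq> 0 \<and> p i = span {P i}" by metis
  interpret arrangement E P
  proof
    show "finite E" by (rule finite_ground)
    show "P i \<noteq> 0" if "i \<in> E" for i using P that by blast
    fix i j assume ij: "i \<in> E" "j \<in> E" "i \<noteq> j"
    show "cross3 (P i) (P j) \<noteq> 0"
    proof
      assume "cross3 (P i) (P j) = 0"
      then obtain c where c: "P j = c *\<^sub>R P i"
        using P ij by (auto simp: cross_eq_0 collinear_lemma)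
      then have "c \<noteq> 0" using P ij by auto
      then have "P i = (1 / c) *\<^sub>R P j" using c by simp
      then have "P i \<in> span {P j}" "P j \<in> span {P i}"
        using c by (metis span_base span_scale singletonI)+
      then have "span {P i} = span {P j}" by (intro equalityI span_minimal) auto
      then have "p i = p j" using P ij by simp
      then show False using inj ij by (auto dest: inj_onD)
    qed
  qed
  have coll_iff: "proj_collinear (p ` S) \<longleftrightarrow> (\<exists>W. subspace W \<and> dim W = 2 \<and> (\<forall>k\<in>S. P k \<in> W))"
    if "S \<subseteq> E" for S
  proof -
    have "p k \<subseteq> W \<longleftrightarrow> P k \<in> W" if "subspace W" "k \<in> S" for k W
      using P \<open>S \<subseteq> E\<close> that span_minimal[of "{P k}" W] span_base[of "P k" "{P k}"] by auto
    then show ?thesis unfolding proj_collinear_def proj_lines_def by auto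
  qed
  \<comment> \<open>Realizability turns rank at most 2 into collinearity, and two distinct elements
    of \<open>S\<close> already fix the only possible line.\<close>
  have rank_iff: "rank S \<le> 2 \<longleftrightarrow> S \<subseteq> join i j" if ij: "i \<noteq> j" "i \<in> S" "j \<in> S" and S: "S \<subseteq> E" for S i j
  proof -
    have ijE: "i \<in> E" "j \<in> E" using ij S by auto
    let ?v = "cross3 (P i) (P j)"
    have v: "?v \<noteq> 0" using cross_nonzero ijE ij(1) by blast
    show ?thesis
    proof
      assume "S \<subseteq> join i j"
      then have "\<forall>k\<in>S. P k \<in> {x. ?v \<bullet> x = 0}" by (auto simp: join_def inner_commute)
      moreover have "subspace {x. ?v \<bullet> x = 0}" by (rule subspace_hyperplane)
      moreover have "dim {x. ?v \<bullet> x = 0} = 2" using dim_hyperplane[OF v] by simp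
      ultimately show "rank S \<le> 2" using coll[OF S] coll_iff[OF S] by blast
    next
      assume "rank S \<le> 2"
      then obtain W where W: "subspace W" "dim W = 2" "\<forall>k\<in>S. P k \<in> W"
        using coll[OF S] coll_iff[OF S] by blast
      \<comment> \<open>Otherwise \<open>P i\<close>, \<open>P j\<close> and \<open>P k\<close>
        would be a basis inside \<open>W\<close>, making \<open>W\<close> the whole space.\<close>
      have "P k \<bullet> ?v = 0" if "k \<in> S" for k
      proof (rule ccontr)
        assume nz: "P k \<bullet> ?v \<noteq> 0"
        have "x \<in> W" for x
        proof -
          have "(P k \<bullet> ?v) *\<^sub>R x \<in> W"
            unfolding cramer_cross3[of "P k" "P i" "P j" x] using W ij \<open>k \<in> S\<close>
            by (intro subspace_add subspace_scale) auto
          then have "(1 / (P k \<bullet> ?v)) *\<^sub>R (P k \<bullet> ?v) *\<^sub>R x \<in> W" by (rule subspace_scale[OF W(1)])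
          then show ?thesis using nz by simp
        qed
        then have "W = UNIV" by blast
        then show False using W(2) by simp
      qed
      then show "S \<subseteq> join i j" using S by (auto simp: join_def)
    qed
  qed
  \<comment> \<open>This transfers the hypotheses on the sizes and number of lines to the
    joins.\<close>
  have line_iff: "line L \<longleftrightarrow> L \<in> joins" for L
  proof
    assume "line L"
    then have L: "L \<subseteq> E" "rank L = 2" "\<And>x. x \<in> E - L \<Longrightarrow> rank L < rank (insert x L)"
      by (auto simp: line_def flat_def)
    obtain I where "I \<subseteq> L" "card I = 2" using rank_attained[of L] L(2) by auto
    then obtain i j where ij: "i \<noteq> j" "i \<in> L" "j \<in> L" by (auto simp: card_2_iff)
    have "L \<subseteq> join i j" using rank_iff[OF ij L(1)] L(2) by simp
    moreover have "x \<in> L" if x: "x \<in> join i j" for x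
    proof (rule ccontr)
      assume "x \<notin> L"
      moreover have "x \<in> E" using x join_subset by blast
      ultimately have "\<not> rank (insert x L) \<le> 2" using L(3)[of x] L(2) by simp
      then show False
        using rank_iff[of i j "insert x L"] ij L(1) \<open>x \<in> E\<close> \<open>L \<subseteq> join i j\<close> x by simp
    qed
    ultimately have "L = join i j" by blast
    then show "L \<in> joins" using join_in_joins ij L(1) by auto
  next
    assume "L \<in> joins"
    then obtain i j where L: "L = join i j" and ij: "i \<in> E" "j \<in> E" "i \<noteq> j"
      by (auto simp: joins_def)
    have LE: "L \<subseteq> E" and mem: "i \<in> L" "j \<in> L" using L ij join_subset by auto
    have "rank L \<le> 2" using rank_iff[OF ij(3) mem LE] L by simp
    moreover have "card {i, j} \<le> rank L"
      using card_le_rank simple_indep_pair[OF simple ij] mem by simp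
    ultimately have "rank L = 2" using ij(3) by simp
    moreover have "rank L < rank (insert x L)" if "x \<in> E - L" for x
      using rank_iff[of i j "insert x L"] ij mem LE L that \<open>rank L = 2\<close> by auto
    ultimately show "line L" using LE by (auto simp: line_def flat_def)
  qed
  interpret spread_arrangement E P
  proof
    show "card (join b d) + 4 \<le> card E" if "b \<in> E" "d \<in> E" "b \<noteq> d" for b d
      using card_line_le[of "join b d"] line_iff join_in_joins[OF that] card_ground by simp
    show "3 \<le> card E" using card_ground by simp
  qed
  let ?K = "{L \<in> joins. card L = 4}"
  \<comment> \<open>Double counting: 16 points lie on four 4-point lines each, giving 64 incidences,
    hence 16 such lines.\<close>
  have "(\<Sum>x\<in>E. card {L. line L \<and> x \<in> L \<and> card L = 4}) = 64"
    using four_lines card_ground by simp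
  moreover have "{L. line L \<and> x \<in> L \<and> card L = 4} = {L \<in> ?K. x \<in> L}" for x
    using line_iff by blast
  ultimately have "64 = (\<Sum>x\<in>E. card {L \<in> ?K. x \<in> L})" by simp
  also have "\<dots> = (\<Sum>L\<in>?K. card {x \<in> E. x \<in> L})"
    using finite_joins finite_ground by (intro sum_multicount_gen) auto
  also have "\<dots> = (\<Sum>L\<in>?K. 4)"
  proof (rule sum.cong)
    fix L assume "L \<in> ?K"
    moreover from this have "{x \<in> E. x \<in> L} = L" using join_subset by (auto simp: joins_def)
    ultimately show "card {x \<in> E. x \<in> L} = 4" by simp
  qed simp
  finally have "card ?K = 16" by simp
  then show False
    using no_sixteen_joins_of_card_4 card_ground card_line_le line_iff by blast
qed

end
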